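(* Let $n>1$ be a natural number. Let $\zeta$ be the order type of $\mathscr{D}^{\|n\|}\cap[0,\delta(n))$. Then $D(n)$ is equal to the smallest integer $k\ge 0$ such that $\zeta<\omega^k$. The same is true if we replace $\delta(n)$ by $\delta_{st}(n)$, $\mathscr{D}^{\|n\|}$ by $\mathscr{D}^{\|n\|_{st}}_{st}$, and $D(n)$ by $D_{st}(n)$; that is, if $\zeta'$ is the order type of $\mathscr{D}^{\|n\|_{st}}_{st}\cap[0,\delta_{st}(n))$, then $D_{st}(n)$ is equal to the smallest integer $k\ge 0$ such that $\zeta'<\omega^k$. (Superscripts $\|n\|$, $\|n\|_{st}$ are read modulo $3$.)
   Context: Natural numbers are positive integers. The complexity $\|n\|$ of a natural number $n$ is the least number of $1$'s needed to write $n$ using any combination of addition and multiplication (with arbitrary parenthesization). The defect of $n$ is $\delta(n)=\|n\|-3\log_3 n$. For $k\ge 1$, $E(k)$ is the largest natural number $n$ with $\|n\|\le k$. $L(n)$ is the largest $k\ge 1$ with $E(k)\le n$, and the integer defect of $n$ is $D(n)=\|n\|-L(n)$. A natural number $m$ is stable if $\|3^k m\|=3k+\|m\|$ for every $k\ge 0$. It is known that for every $n$ there is $k\ge 0$ with $3^k n$ stable. For any $k\ge 0$ such that $3^kn$ is stable, set $\|n\|_{st}=\|3^kn\|-3k$ (stable complexity), $\delta_{st}(n)=\delta(3^kn)$ (stable defect), and $D_{st}(n)=D(3^kn)$ (stable integer defect); these do not depend on the choice of $k$. For $a$ a congruence class modulo $3$, $\mathscr{D}^a=\{\delta(n): \|n\|\equiv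 a \pmod 3,\ n\neq 1\}$, which is known to be a well-ordered subset of $\mathbb{R}$ (of order type $\omega^\omega$). $\mathscr{D}_{st}$ is the set of all $\delta(n)$ with $n$ stable, and $\mathscr{D}^a_{st}=\mathscr{D}^a\cap\mathscr{D}_{st}$. Here $\omega^k$ is ordinal exponentiation, with $\omega^0=1$. *)

theory Defs
  imports Complex_Main "HOL-Number_Theory.Cong"
begin

section \<open>Integer complexity and the defect\<close>

datatype ones_expr = EOne | EAdd ones_expr ones_expr | EMul ones_expr ones_expr

primrec expr_val :: "ones_expr \<Rightarrow> nat" where
  "expr_val EOne = 1"
| "expr_val (EAdd a b) = expr_val a + expr_val b"
| "expr_val (EMul a b) = expr_val a * expr_val b"

primrec expr_ones :: "ones_expr \<Rightarrow> nat" where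
  "expr_ones EOne = 1"
| "expr_ones (EAdd a b) = expr_ones a + expr_ones b"
| "expr_ones (EMul a b) = expr_ones a + expr_ones b"

text \<open>The natural numbers of the theory are the positive ones; all notions below are meaningful
  only for positive arguments, and sets of natural numbers are restricted accordingly.\<close>

definition cpx :: "nat \<Rightarrow> nat" where
  "cpx n = (LEAST k. \<exists>e. expr_val e = n \<and> expr_ones e = k)"

definition defect :: "nat \<Rightarrow> real" where
  "defect n = real (cpx n) - 3 * log 3 (real n)"

text \<open>These are $E(k)$, $L(n)$ and $D(n)$; the greatest elements exist for \<open>k \<ge> 1\<close> and \<open>n \<ge> 1\<close>
  (\<open>Emax_greatest\<close> and \<open>Lmax_greatest\<close> below).\<close>

definition Emax :: "nat \<Rightarrow> nat" where
  "Emax k = (GREATEST n. n > 0 \<and> cpx n \<le> k)"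

definition Lmax :: "nat \<Rightarrow> nat" where
  "Lmax n = (GREATEST k. k \<ge> 1 \<and> Emax k \<le> n)"

definition int_defect :: "nat \<Rightarrow> int" where
  "int_defect n = int (cpx n) - int (Lmax n)"


section \<open>Stabilization\<close>

definition stable_num :: "nat \<Rightarrow> bool" where
  "stable_num m \<longleftrightarrow> m > 0 \<and> (\<forall>k. cpx (3 ^ k * m) = 3 * k + cpx m)"

text \<open>The stable notions may be computed from any \<open>k\<close> with \<open>stable_num (3 ^ k * n)\<close>; we take the least
  one. Such a \<open>k\<close> exists (\<open>stable_exists\<close>), and the choice is immaterial
  (\<open>cpx_st_eq\<close>, \<open>defect_st_eq\<close>, \<open>int_defect_st_eq\<close>).\<close>

definition stable_exp :: "nat \<Rightarrow> nat" where
  "stable_exp n = (LEAST k. stable_num (3 ^ k * n))"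

definition cpx_st :: "nat \<Rightarrow> int" where
  "cpx_st n = int (cpx (3 ^ stable_exp n * n)) - 3 * int (stable_exp n)"

definition defect_st :: "nat \<Rightarrow> real" where
  "defect_st n = defect (3 ^ stable_exp n * n)"

definition int_defect_st :: "nat \<Rightarrow> int" where
  "int_defect_st n = int_defect (3 ^ stable_exp n * n)"


section \<open>Sets of defects\<close>

text \<open>The congruence class is given by an arbitrary integer representative \<open>a\<close>.\<close>

definition defects :: "int \<Rightarrow> real set" where
  "defects a = {defect n | n. n > 0 \<and> n \<noteq> 1 \<and> [int (cpx n) = a] (mod 3)}"

definition stable_defects :: "real set" where
  "stable_defects = {defect n | n. stable_num n}"

definition defects_st :: "int \<Rightarrow> real set" where
  "defects_st a = defects a \<inter> stable_defects"


section \<open>Order types\<close>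

text \<open>Ordinals are represented by well-orders (reflexive relations, carried by their field) and
  compared by \<^term>\<open>ordLess\<close>, which also asserts that both sides are well-orders.\<close>

definition ord_type :: "real set \<Rightarrow> real rel" where
  "ord_type S = relation_of (\<le>) S"

text \<open>$\omega^0 = 1$ and $\omega^{k+1} = \omega^k \cdot \omega$, the product being $\omega$
  consecutive copies of $\omega^k$: in \<open>x # xs\<close>, the head is the index of the copy.\<close>

primrec omega_pow :: "nat \<Rightarrow> nat list rel" where
  "omega_pow 0 = {([], [])}"
| "omega_pow (Suc k) = {(x # xs, y # ys) | x xs y ys.
     xs \<in> Field (omega_pow k) \<and> ys \<in> Field (omega_pow k) \<and>
     (x < y \<or> x = y \<and> (xs, ys) \<in> omega_pow k)}"


section \<open>Well-definedness\<close>

subsection \<open>The powers of $\omega$ are well-orders\<close>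

lemma Field_omega_powI:
  assumes "\<And>xs ys. (xs, ys) \<in> omega_pow k \<Longrightarrow> length xs = k \<and> length ys = k"
    and "\<And>xs. length xs = k \<Longrightarrow> (xs, xs) \<in> omega_pow k"
  shows "Field (omega_pow k) = {xs. length xs = k}"
  using assms unfolding Field_def by fast

lemma omega_pow_length_refl:
  "(\<forall>xs ys. (xs, ys) \<in> omega_pow k \<longrightarrow> length xs = k \<and> length ys = k) \<and>
   (\<forall>xs. length xs = k \<longrightarrow> (xs, xs) \<in> omega_pow k)"
proof (induction k)
  case (Suc k)
  then have F: "Field (omega_pow k) = {xs. length xs = k}" by (intro Field_omega_powI) auto
  show ?case
  proof (intro conjI allI impI)
    fix xs :: "nat list" assume "length xs = Suc k"
    then obtain z zs where z: "xs = z # zs" "length zs = k" by (cases xs) auto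
    then have "(zs, zs) \<in> omega_pow k" using Suc by blast
    then show "(xs, xs) \<in> omega_pow (Suc k)" using z by (simp add: F)
  qed (auto simp: F)
qed simp

lemma Field_omega_pow: "Field (omega_pow k) = {xs. length xs = k}"
  using omega_pow_length_refl by (intro Field_omega_powI) auto

lemma omega_pow_Suc_iff:
  "(x # xs, y # ys) \<in> omega_pow (Suc k) \<longleftrightarrow> length xs = k \<and> length ys = k \<and>
     (x < y \<or> x = y \<and> (xs, ys) \<in> omega_pow k)"
  by (simp add: Field_omega_pow)

lemma omega_pow_lex:
  "(xs, ys) \<in> omega_pow k \<longleftrightarrow>
     length xs = k \<and> length ys = k \<and> ((xs, ys) \<in> lex less_than \<or> xs = ys)"
proof (induction k arbitrary: xs ys)
  case (Suc k)
  have "length xs = Suc k \<and> length ys = Suc k" if "(xs, ys) \<in> omega_pow (Suc k)"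
    using that omega_pow_length_refl by blast
  moreover have "?case" if len: "length xs = Suc k" "length ys = Suc k"
  proof -
    obtain x xs' where x: "xs = x # xs'" using len(1) by (cases xs) auto
    obtain y ys' where y: "ys = y # ys'" using len(2) by (cases ys) auto
    show ?thesis
      unfolding x y omega_pow_Suc_iff Suc.IH Cons_in_lex using len by (auto simp: x y)
  qed
  ultimately show ?case by blast
qed auto

lemma Well_order_omega_pow: "Well_order (omega_pow k)"
proof -
  have wf: "wf (lex (less_than :: nat rel))" by (simp add: wf_lex)
  have irr: "(xs, xs) \<notin> lex less_than" for xs :: "nat list" using wf by (rule wf_not_refl)
  have tr: "trans (lex (less_than :: nat rel))" by (rule lex_transI) simp
  have "refl_on (Field (omega_pow k)) (omega_pow k)"
    by (rule refl_onI) (simp add: Field_omega_pow omega_pow_lex)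
  moreover have "trans (omega_pow k)"
  proof (rule transI)
    fix xs ys zs assume "(xs, ys) \<in> omega_pow k" "(ys, zs) \<in> omega_pow k"
    then show "(xs, zs) \<in> omega_pow k"
      using transD[OF tr, of xs ys zs] unfolding omega_pow_lex by metis
  qed
  moreover have "antisym (omega_pow k)"
  proof (rule antisymI)
    fix xs ys assume "(xs, ys) \<in> omega_pow k" "(ys, xs) \<in> omega_pow k"
    then show "xs = ys"
      using transD[OF tr, of xs ys xs] irr[of xs] unfolding omega_pow_lex by metis
  qed
  moreover have "total_on (Field (omega_pow k)) (omega_pow k)"
  proof (induction k)
    case (Suc k)
    show ?case
    proof (rule total_onI)
      fix xs ys assume a: "xs \<in> Field (omega_pow (Suc k))" "ys \<in> Field (omega_pow (Suc k))" "xs \<noteq> ys"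
      obtain x xs' where x: "xs = x # xs'" "length xs' = k"
        using a(1) by (cases xs) (auto simp: Field_omega_pow simp del: omega_pow.simps)
      obtain y ys' where y: "ys = y # ys'" "length ys' = k"
        using a(2) by (cases ys) (auto simp: Field_omega_pow simp del: omega_pow.simps)
      have "xs' = ys' \<or> (xs', ys') \<in> omega_pow k \<or> (ys', xs') \<in> omega_pow k"
        using Suc x(2) y(2) by (auto simp: total_on_def Field_omega_pow)
      then show "(xs, ys) \<in> omega_pow (Suc k) \<or> (ys, xs) \<in> omega_pow (Suc k)"
        using a(3) x(2) y(2) unfolding x(1) y(1) omega_pow_Suc_iff by (cases x y rule: linorder_cases) auto
    qed
  qed (simp add: total_on_def Field_omega_pow)
  moreover have "wf (omega_pow k - Id)"
    by (rule wf_subset[OF wf]) (auto simp: omega_pow_lex)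
  ultimately show ?thesis
    by (auto simp: well_order_on_def linear_order_on_def partial_order_on_def preorder_on_def
        intro: FieldI1 FieldI2)
qed


subsection \<open>Complexity, $E$ and $L$\<close>

lemma expr_exists: "n > 0 \<Longrightarrow> \<exists>e. expr_val e = n"
proof (induction n)
  case (Suc n)
  show ?case
  proof (cases "n = 0")
    case False
    with Suc obtain e where "expr_val e = n" by auto
    then have "expr_val (EAdd e EOne) = Suc n" by simp
    then show ?thesis by blast
  qed (auto intro: exI[of _ EOne])
qed simp

lemma cpx_attained:
  assumes "n > 0"
  obtains e where "expr_val e = n" "expr_ones e = cpx n"
  using LeastI_ex[of "\<lambda>k. \<exists>e. expr_val e = n \<and> expr_ones e = k"] expr_exists[OF assms]
  unfolding cpx_def by blast

lemma cpx_le: "cpx (expr_val e) \<le> expr_ones e"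
  unfolding cpx_def by (rule Least_le) blast

lemma expr_ones_pos: "expr_ones e \<ge> 1"
  by (induction e) auto

lemma cpx_pos: "n > 0 \<Longrightarrow> cpx n \<ge> 1"
  by (metis cpx_attained expr_ones_pos)

fun Eform :: "nat \<Rightarrow> nat" where
  "Eform 0 = 0"
| "Eform (Suc 0) = 1"
| "Eform (Suc (Suc 0)) = 2"
| "Eform (Suc (Suc (Suc 0))) = 3"
| "Eform (Suc (Suc (Suc (Suc 0)))) = 4"
| "Eform (Suc (Suc (Suc (Suc (Suc k))))) = 3 * Eform (Suc (Suc k))"

lemma Eform_add3: "k \<ge> 2 \<Longrightarrow> Eform (k + 3) = 3 * Eform k"
proof -
  assume "k \<ge> 2"
  then obtain j where "k = Suc (Suc j)" by (metis add_2_eq_Suc le_Suc_ex)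
  then show ?thesis by (simp add: numeral_eq_Suc)
qed

lemma Eform_Suc: "Eform k + 1 \<le> Eform (Suc k)"
  by (induction k rule: Eform.induct) auto

lemma Eform_mono_strict: "strict_mono Eform"
  unfolding strict_mono_Suc_iff using Eform_Suc by (simp add: Suc_le_eq)

lemma Eform_mult: "a \<ge> 1 \<Longrightarrow> b \<ge> 1 \<Longrightarrow> Eform a * Eform b \<le> Eform (a + b)"
proof (induction "a + b" arbitrary: a b rule: less_induct)
  case less
  show ?case
  proof (cases "a \<ge> 5 \<or> b \<ge> 5")
    case True
    have *: "Eform c * Eform d \<le> Eform (c + d)"
      if "c + d = a + b" "c \<ge> 5" "d \<ge> 1" for c d
    proof -
      have "Eform (c - 3) * Eform d \<le> Eform (c - 3 + d)"
        using that by (intro less) auto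
      moreover have "Eform c = 3 * Eform (c - 3)"
        using Eform_add3[of "c - 3"] that by simp
      moreover have "Eform (c + d) = 3 * Eform (c - 3 + d)"
        using Eform_add3[of "c - 3 + d"] that by simp
      ultimately show ?thesis by simp
    qed
    show ?thesis using *[of a b] *[of b a] True less.prems by (auto simp: algebra_simps)
  next
    case False
    with less.prems have "a \<in> {1,2,3,4}" "b \<in> {1,2,3,4}" by auto
    then show ?thesis by (auto simp: numeral_eq_Suc)
  qed
qed

lemma Eform_ge: "k \<le> Eform k"
  by (rule strict_mono_imp_increasing[OF Eform_mono_strict])

lemma Eform_add: 
  assumes "a \<ge> 1" "b \<ge> 1"
  shows "Eform a + Eform b \<le> Eform (a + b)"
proof -
  consider "a = 1" | "b = 1" | "a \<ge> 2" "b \<ge> 2" using assms by linarith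
  then show ?thesis
  proof cases
    case 3
    then have "Eform a \<ge> 2" "Eform b \<ge> 2" using Eform_ge[of a] Eform_ge[of b] by linarith+
    then obtain c d where "Eform a = 2 + c" "Eform b = 2 + d" by (metis le_iff_add)
    then have "Eform a + Eform b \<le> Eform a * Eform b" by (simp add: algebra_simps)
    then show ?thesis using Eform_mult[OF assms] by simp
  qed (use Eform_Suc in \<open>auto simp: add.commute\<close>)
qed

lemma expr_val_le: "expr_val e \<le> Eform (expr_ones e)"
proof (induction e)
  case (EAdd a b)
  then show ?case using Eform_add[OF expr_ones_pos[of a] expr_ones_pos[of b]] by simp
next
  case (EMul a b)
  then have "expr_val a * expr_val b \<le> Eform (expr_ones a) * Eform (expr_ones b)"
    by (rule mult_le_mono)
  then show ?case using Eform_mult[OF expr_ones_pos[of a] expr_ones_pos[of b]] by simp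
qed simp

lemma le_Eform_cpx: "n > 0 \<Longrightarrow> n \<le> Eform (cpx n)"
  by (metis cpx_attained expr_val_le)

lemma Eform_attained: "k \<ge> 1 \<Longrightarrow> \<exists>e. expr_val e = Eform k \<and> expr_ones e = k"
proof (induction k rule: Eform.induct)
  case 2
  show ?case by (rule exI[of _ EOne]) simp
next
  case 3
  show ?case by (rule exI[of _ "EAdd EOne EOne"]) simp
next
  case 4
  show ?case by (rule exI[of _ "EAdd EOne (EAdd EOne EOne)"]) simp
next
  case 5
  show ?case by (rule exI[of _ "EAdd (EAdd EOne EOne) (EAdd EOne EOne)"]) simp
next
  case (6 k)
  then obtain e where "expr_val e = Eform (Suc (Suc k))" "expr_ones e = Suc (Suc k)" by auto
  then show ?case by (intro exI[of _ "EMul (EAdd EOne (EAdd EOne EOne)) e"]) simp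
qed simp

lemma Eform_greatest:
  assumes "k \<ge> 1"
  shows "Eform k > 0 \<and> cpx (Eform k) \<le> k" and "n > 0 \<Longrightarrow> cpx n \<le> k \<Longrightarrow> n \<le> Eform k"
proof -
  show "Eform k > 0 \<and> cpx (Eform k) \<le> k"
  proof
    show "Eform k > 0" using Eform_ge[of k] assms by linarith
    show "cpx (Eform k) \<le> k" using Eform_attained[OF assms] cpx_le by metis
  qed
  show "n \<le> Eform k" if "n > 0" "cpx n \<le> k"
    using le_Eform_cpx[OF that(1)] monoD[OF strict_mono_mono[OF Eform_mono_strict] that(2)]
    by simp
qed

lemma Emax_eq: "k \<ge> 1 \<Longrightarrow> Emax k = Eform k"
  unfolding Emax_def using Eform_greatest by (intro Greatest_equality) auto

lemma Emax_greatest: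
  assumes "k \<ge> 1"
  shows "Emax k > 0 \<and> cpx (Emax k) \<le> k" and "n > 0 \<Longrightarrow> cpx n \<le> k \<Longrightarrow> n \<le> Emax k"
  using Eform_greatest[OF assms] Emax_eq[OF assms] by auto

lemma Lmax_greatest:
  assumes "n \<ge> 1"
  shows "Lmax n \<ge> 1 \<and> Emax (Lmax n) \<le> n" and "k \<ge> 1 \<Longrightarrow> Emax k \<le> n \<Longrightarrow> k \<le> Lmax n"
proof -
  have bound: "\<And>k. k \<ge> 1 \<and> Emax k \<le> n \<Longrightarrow> k \<le> n"
    using Emax_eq Eform_ge by (metis le_trans)
  have ex: "1 \<ge> (1::nat) \<and> Emax 1 \<le> n" using assms by (simp add: Emax_eq)
  show "Lmax n \<ge> 1 \<and> Emax (Lmax n) \<le> n"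
    unfolding Lmax_def
    by (rule GreatestI_nat[where P = "\<lambda>k. k \<ge> 1 \<and> Emax k \<le> n", OF ex bound])
  show "k \<le> Lmax n" if "k \<ge> 1" "Emax k \<le> n"
    unfolding Lmax_def using that bound
    by (intro Greatest_le_nat[where P = "\<lambda>k. k \<ge> 1 \<and> Emax k \<le> n"]) auto
qed

lemma Lmax_3: 
  assumes "n \<ge> 2"
  shows "Lmax (3 * n) = Lmax n + 3"
proof -
  define l where "l = Lmax n"
  have "l \<ge> 2" unfolding l_def using assms
    by (intro Lmax_greatest(2)) (auto simp: Emax_eq numeral_2_eq_2)
  have le: "Eform l \<le> n"
    using Lmax_greatest(1)[of n] assms Emax_eq[of l] \<open>l \<ge> 2\<close> by (simp add: l_def)
  have gt: "Eform (Suc l) > n"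
    using Lmax_greatest(2)[of n "Suc l"] assms Emax_eq[of "Suc l"] by (force simp: l_def)
  show ?thesis unfolding l_def[symmetric]
  proof (rule antisym)
    have "Emax (l + 3) \<le> 3 * n"
      using Eform_add3[OF \<open>l \<ge> 2\<close>] le by (simp add: Emax_eq)
    then show "l + 3 \<le> Lmax (3 * n)" using assms by (intro Lmax_greatest(2)) auto
    have L: "Lmax (3 * n) \<ge> 1" "Eform (Lmax (3 * n)) \<le> 3 * n"
      using Lmax_greatest(1)[of "3 * n"] assms by (auto simp: Emax_eq)
    have "Eform (Suc l + 3) > 3 * n"
      using Eform_add3[of "Suc l"] \<open>l \<ge> 2\<close> gt by simp
    then have "Eform (Lmax (3 * n)) < Eform (Suc l + 3)" using L(2) by linarith
    then show "Lmax (3 * n) \<le> l + 3"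
      using strict_mono_less[OF Eform_mono_strict] by auto
  qed
qed


subsection \<open>Stable numbers\<close>

lemma cpx_3: "n > 0 \<Longrightarrow> cpx (3 * n) \<le> cpx n + 3"
proof -
  assume "n > 0"
  then obtain e where "expr_val e = n" "expr_ones e = cpx n" by (rule cpx_attained)
  then show ?thesis using cpx_le[of "EMul (EAdd EOne (EAdd EOne EOne)) e"] by (simp add: numeral_3_eq_3)
qed

lemma cpx_3_pow: "n > 0 \<Longrightarrow> cpx (3 ^ k * n) \<le> cpx n + 3 * k"
proof (induction k)
  case (Suc k)
  then show ?case using cpx_3[of "3 ^ k * n"] by (simp add: mult.assoc)
qed simp

lemma Eform_3: "k \<ge> 1 \<Longrightarrow> Eform (3 * k) = 3 ^ k"
proof (induction k rule: dec_induct)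
  case (step k)
  then show ?case using Eform_add3[of "3 * k"] by (simp add: algebra_simps)
qed (simp add: numeral_3_eq_3)

lemma cpx_3_pow_ge: "n > 0 \<Longrightarrow> 3 * k \<le> cpx (3 ^ k * n)"
proof (cases "k = 0")
  case False
  assume "n > 0"
  show ?thesis
  proof (rule ccontr)
    assume "\<not> ?thesis"
    then have "Eform (cpx (3 ^ k * n)) < Eform (3 * k)"
      using strict_monoD[OF Eform_mono_strict] by auto
    also have "\<dots> = 3 ^ k" using False by (simp add: Eform_3)
    also have "\<dots> \<le> 3 ^ k * n" using \<open>n > 0\<close> by simp
    also have "\<dots> \<le> Eform (cpx (3 ^ k * n))" using \<open>n > 0\<close> by (intro le_Eform_cpx) simp
    finally show False by simp
  qed
qed simp

lemma stable_exists:
  assumes "n > 0"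
  shows "\<exists>k. stable_num (3 ^ k * n)"
proof -
  define f where "f k = cpx (3 ^ k * n) - 3 * k" for k
  have f: "cpx (3 ^ k * n) = f k + 3 * k" for k
    using cpx_3_pow_ge[OF assms] by (simp add: f_def)
  define k where "k = arg_min f (\<lambda>_. True)"
  have k_min: "f k \<le> f j" for j unfolding k_def by (rule arg_min_nat_le) simp
  have "cpx (3 ^ j * (3 ^ k * n)) = 3 * j + cpx (3 ^ k * n)" for j
  proof (rule antisym)
    show "cpx (3 ^ j * (3 ^ k * n)) \<le> 3 * j + cpx (3 ^ k * n)"
      using cpx_3_pow[of "3 ^ k * n" j] assms by simp
    have eq: "3 ^ j * (3 ^ k * n) = 3 ^ (k + j) * n"
      by (simp add: power_add mult.commute mult.left_commute)
    show "3 * j + cpx (3 ^ k * n) \<le> cpx (3 ^ j * (3 ^ k * n))"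
      unfolding eq using f[of k] f[of "k + j"] k_min[of "k + j"] by simp
  qed
  then show ?thesis using assms by (auto simp: stable_num_def)
qed

lemma stable_stable_exp: "n > 0 \<Longrightarrow> stable_num (3 ^ stable_exp n * n)"
  unfolding stable_exp_def by (rule LeastI_ex[OF stable_exists])

lemma stable_shift:
  assumes "stable_num (3 ^ k * n)"
  shows "\<exists>j. k = stable_exp n + j \<and> 3 ^ k * n = 3 ^ j * (3 ^ stable_exp n * n)"
proof -
  have "stable_exp n \<le> k" unfolding stable_exp_def using assms by (rule Least_le)
  then obtain j where "k = stable_exp n + j" by (auto simp: le_iff_add)
  then show ?thesis by (auto simp: power_add)
qed

lemma stable_pos: "stable_num (3 ^ k * n) \<Longrightarrow> n > 0"
  by (auto simp: stable_num_def)

lemma cpx_st_eq: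
  assumes "stable_num (3 ^ k * n)"
  shows "cpx_st n = int (cpx (3 ^ k * n)) - 3 * int k"
proof -
  obtain j where j: "k = stable_exp n + j" "3 ^ k * n = 3 ^ j * (3 ^ stable_exp n * n)"
    using stable_shift[OF assms] by blast
  have "cpx (3 ^ k * n) = 3 * j + cpx (3 ^ stable_exp n * n)"
    using stable_stable_exp[OF stable_pos[OF assms]] unfolding j(2) stable_num_def by blast
  then show ?thesis using j(1) by (simp add: cpx_st_def)
qed

lemma defect_st_eq:
  assumes "stable_num (3 ^ k * n)"
  shows "defect_st n = defect (3 ^ k * n)"
proof -
  have *: "defect (3 ^ i * n) = real_of_int (int (cpx (3 ^ i * n)) - 3 * int i) - 3 * log 3 (real n)" for i
    using stable_pos[OF assms] by (simp add: defect_def log_mult log_nat_power)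
  show ?thesis
    using cpx_st_eq[OF assms] unfolding defect_st_def * cpx_st_def by simp
qed

lemma int_defect_st_eq:
  assumes "stable_num (3 ^ k * n)"
  shows "int_defect_st n = int_defect (3 ^ k * n)"
proof -
  let ?m = "3 ^ stable_exp n * n"
  obtain j where j: "k = stable_exp n + j" "3 ^ k * n = 3 ^ j * ?m"
    using stable_shift[OF assms] by blast
  have st: "stable_num ?m" by (rule stable_stable_exp[OF stable_pos[OF assms]])
  have "?m \<noteq> 1"
  proof
    assume "?m = 1"
    then have "cpx (3 ^ 1 * 1) = 3 * 1 + cpx 1" using st unfolding stable_num_def by metis
    moreover have "cpx 3 \<le> 3" using cpx_le[of "EAdd EOne (EAdd EOne EOne)"] by (simp add: numeral_3_eq_3)
    moreover have "cpx 1 \<ge> 1" by (rule cpx_pos) simp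
    ultimately show False by simp
  qed
  then have m2: "?m \<ge> 2" using st unfolding stable_num_def by linarith
  have "Lmax (3 ^ j * ?m) = Lmax ?m + 3 * j"
  proof (induction j)
    case (Suc j)
    have "1 * 2 \<le> 3 ^ j * ?m" using m2 by (intro mult_le_mono) auto
    then have "Lmax (3 * (3 ^ j * ?m)) = Lmax (3 ^ j * ?m) + 3" by (intro Lmax_3) simp
    then show ?case using Suc by (simp add: mult.assoc)
  qed simp
  moreover have "cpx (3 ^ j * ?m) = 3 * j + cpx ?m" using st unfolding stable_num_def by blast
  ultimately show ?thesis unfolding int_defect_st_def int_defect_def j(2) by simp
qed

end

theory Submission
  imports Defs "HOL-Library.Infinite_Set"
begin

text \<open>For numbers of complexity $\equiv a$, the condition $D(n) \le k$ means that $\delta(n)$ is at most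
  $t_a(k) = k + \delta_{a-k}$, where $\delta_r$ is the least defect of the class \<open>r\<close>. So it suffices
  that the defects of class \<open>a\<close> up to any $x < t_a(k)$ have type less than $\omega^k$, whereas the
  stable ones up to $t_a(k)$ do not.

  For the upper bound, write $n$ optimally. If $n = uv$, then $\delta(n) = \delta(u) + \delta(v)$, and
  natural products of order types match the superadditivity of the thresholds. If $n = u + v$ with
  $v \le u$, then $v$ is bounded and $\delta(n) = \delta(u) + \|v\| - 3 \log_3(1 + v/u)$: the defect of $u$
  is smaller by about $\|v\| \ge 1$, and the correction tending to 0 costs one factor $\omega$.

  For the lower bound, numbers $(\cdots(E\,3^{x_1} + 1) \cdots)\,3^{x_k} + 1$ give a copy of $\omega^k$ below
  $t_a(k)$ if one pretends that these representations are optimal and stable. The exceptions have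
  defects lying in other classes below smaller thresholds, so by the upper bound they are too few.\<close>

section \<open>Sets of reals of order type below a power of $\omega$\<close>

text \<open>\<open>rank_lt k S\<close> says that \<open>S\<close> is well-ordered of type less than $\omega^k$
  (\<open>ordLess_omega_pow_iff\<close>). The pieces \<open>P\<close> have type at most $\omega^{k-1}$; since they may
  interleave, closure under unions is immediate, and the indecomposability of $\omega^k$ is only
  needed to return to order types.\<close>

primrec rank_lt :: "nat \<Rightarrow> real set \<Rightarrow> bool" where
  "rank_lt 0 S \<longleftrightarrow> S = {}"
| "rank_lt (Suc k) S \<longleftrightarrow>
     (\<exists>\<P>. finite \<P> \<and> S = \<Union>\<P> \<and> (\<forall>P\<in>\<P>. \<forall>x\<in>P. rank_lt k (P \<inter> {..<x})))"

section \<open>Closure properties of the rank\<close>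

lemma rank_lt_SucI: "(\<And>x. x \<in> S \<Longrightarrow> rank_lt k (S \<inter> {..<x})) \<Longrightarrow> rank_lt (Suc k) S"
  by (auto intro!: exI[of _ "{S}"])

lemma rank_lt_empty [simp]: "rank_lt k {}"
  by (cases k) (auto intro: exI[of _ "{}"])

lemma rank_lt_subset: "rank_lt k S \<Longrightarrow> T \<subseteq> S \<Longrightarrow> rank_lt k T"
proof (induction k arbitrary: S T)
  case (Suc k)
  then obtain \<P> where \<P>: "finite \<P>" "S = \<Union>\<P>" "\<forall>P\<in>\<P>. \<forall>x\<in>P. rank_lt k (P \<inter> {..<x})" by auto
  have "rank_lt k (P \<inter> T \<inter> {..<x})" if "P \<in> \<P>" "x \<in> P" for P x
    using Suc.IH[of "P \<inter> {..<x}" "P \<inter> T \<inter> {..<x}"] \<P>(3) that by blast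
  then show ?case
    unfolding rank_lt.simps using \<P> Suc.prems(2)
    by (intro exI[of _ "(\<lambda>P. P \<inter> T) ` \<P>"]) auto
qed auto

lemma rank_lt_Union:
  assumes "finite \<F>" "\<And>S. S \<in> \<F> \<Longrightarrow> rank_lt k S"
  shows "rank_lt k (\<Union>\<F>)"
proof (cases k)
  case (Suc j)
  then have "\<forall>S\<in>\<F>. \<exists>\<P>. finite \<P> \<and> S = \<Union>\<P> \<and> (\<forall>P\<in>\<P>. \<forall>x\<in>P. rank_lt j (P \<inter> {..<x}))"
    using assms(2) by simp
  then obtain p where p: "\<And>S. S \<in> \<F> \<Longrightarrow> finite (p S)" "\<And>S. S \<in> \<F> \<Longrightarrow> S = \<Union>(p S)"
      "\<And>S P x. S \<in> \<F> \<Longrightarrow> P \<in> p S \<Longrightarrow> x \<in> P \<Longrightarrow> rank_lt j (P \<inter> {..<x})"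
    using bchoice[of \<F>] by metis
  show ?thesis
    unfolding Suc rank_lt.simps
  proof (intro exI conjI ballI)
    show "finite (\<Union>S\<in>\<F>. p S)" using p(1) assms(1) by (rule finite_UN_I[rotated])
    show "\<Union>\<F> = \<Union>(\<Union>S\<in>\<F>. p S)"
    proof -
      have "\<Union>\<F> = (\<Union>S\<in>\<F>. \<Union>(p S))" using p(2) by (simp cong: SUP_cong)
      also have "\<dots> = \<Union>(\<Union>S\<in>\<F>. p S)" by blast
      finally show ?thesis .
    qed
    show "rank_lt j (P \<inter> {..<x})" if "P \<in> (\<Union>S\<in>\<F>. p S)" "x \<in> P" for P x
      using that by (elim UN_E) (rule p(3))
  qed
qed (use assms in auto)

lemma rank_lt_UN: "finite I \<Longrightarrow> (\<And>i. i \<in> I \<Longrightarrow> rank_lt k (S i)) \<Longrightarrow> rank_lt k (\<Union>i\<in>I. S i)"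
  by (rule rank_lt_Union) auto

lemma rank_lt_Un: "rank_lt k S \<Longrightarrow> rank_lt k T \<Longrightarrow> rank_lt k (S \<union> T)"
  using rank_lt_Union[of "{S, T}" k] by auto

lemma rank_lt_Suc: "rank_lt k S \<Longrightarrow> rank_lt (Suc k) S"
  by (rule rank_lt_SucI) (auto intro: rank_lt_subset)

lemma rank_lt_mono: "j \<le> k \<Longrightarrow> rank_lt j S \<Longrightarrow> rank_lt k S"
  by (induction k rule: dec_induct) (use rank_lt_Suc in blast)+

lemma rank_lt_finite:
  assumes "finite S"
  shows "rank_lt (Suc k) S"
proof -
  have "rank_lt (Suc k) (\<Union>x\<in>S. {x})"
    by (intro rank_lt_UN assms rank_lt_SucI) auto
  then show ?thesis by simp
qed

text \<open>If \<open>x + y < p + q\<close> then \<open>x < p\<close> or \<open>y < q\<close>, so an initial segment of a sum of two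
  pieces is covered by two sums of smaller rank.\<close>

lemma rank_lt_sum:
  "rank_lt (Suc i) A \<Longrightarrow> rank_lt (Suc j) B \<Longrightarrow> rank_lt (Suc (i + j)) {x + y | x y. x \<in> A \<and> y \<in> B}"
proof (induction "i + j" arbitrary: i j A B rule: less_induct)
  case less
  from less.prems obtain \<A> where \<A>: "finite \<A>" "A = \<Union>\<A>" "\<forall>P\<in>\<A>. \<forall>x\<in>P. rank_lt i (P \<inter> {..<x})" by auto
  from less.prems obtain \<B> where \<B>: "finite \<B>" "B = \<Union>\<B>" "\<forall>P\<in>\<B>. \<forall>x\<in>P. rank_lt j (P \<inter> {..<x})" by auto
  let ?sum = "\<lambda>P Q. {x + y | x y. x \<in> P \<and> y \<in> Q}"
  have "rank_lt (Suc (i + j)) (?sum P Q)" if "P \<in> \<A>" "Q \<in> \<B>" for P Q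
  proof (rule rank_lt_SucI)
    fix z assume "z \<in> ?sum P Q"
    then obtain p q where pq: "z = p + q" "p \<in> P" "q \<in> Q" by blast
    \<comment> \<open>A piece is its own one-element cover, so the induction hypothesis applies to a
      full piece on one side and a proper initial segment on the other.\<close>
    have P: "rank_lt (Suc i) P" and Q: "rank_lt (Suc j) Q"
      using that \<A>(3) \<B>(3) by (auto intro!: rank_lt_SucI simp del: rank_lt.simps)
    have 1: "rank_lt (i + j) (?sum (P \<inter> {..<p}) Q)"
    proof (cases i)
      case 0
      then have "P \<inter> {..<p} = {}" using \<A>(3) that(1) pq(2) by (metis rank_lt.simps(1))
      then show ?thesis by auto
    next
      case (Suc i')
      then have "rank_lt (Suc i') (P \<inter> {..<p})" using \<A>(3) that(1) pq(2) by metis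
      then show ?thesis using less.hyps[of i' j "P \<inter> {..<p}" Q] Q Suc by simp
    qed
    have 2: "rank_lt (i + j) (?sum P (Q \<inter> {..<q}))"
    proof (cases j)
      case 0
      then have "Q \<inter> {..<q} = {}" using \<B>(3) that(2) pq(3) by (metis rank_lt.simps(1))
      then show ?thesis by auto
    next
      case (Suc j')
      then have "rank_lt (Suc j') (Q \<inter> {..<q})" using \<B>(3) that(2) pq(3) by metis
      then show ?thesis using less.hyps[of i j' P "Q \<inter> {..<q}"] P Suc by simp
    qed
    have "?sum P Q \<inter> {..<z} \<subseteq> ?sum (P \<inter> {..<p}) Q \<union> ?sum P (Q \<inter> {..<q})"
    proof
      fix w assume "w \<in> ?sum P Q \<inter> {..<z}"
      then obtain x y where xy: "w = x + y" "x \<in> P" "y \<in> Q" "x + y < p + q" using pq by auto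
      then have "x < p \<or> y < q" by linarith
      then show "w \<in> ?sum (P \<inter> {..<p}) Q \<union> ?sum P (Q \<inter> {..<q})" using xy by blast
    qed
    then show "rank_lt (i + j) (?sum P Q \<inter> {..<z})"
      using rank_lt_subset[OF rank_lt_Un[OF 1 2]] by blast
  qed
  then have "rank_lt (Suc (i + j)) (\<Union>(P, Q)\<in>\<A> \<times> \<B>. ?sum P Q)"
    using \<A>(1) \<B>(1) by (intro rank_lt_UN) (auto simp del: rank_lt.simps)
  moreover have "?sum A B \<subseteq> (\<Union>(P, Q)\<in>\<A> \<times> \<B>. ?sum P Q)" unfolding \<A>(2) \<B>(2) by fast
  ultimately show ?case by (rule rank_lt_subset)
qed

lemma rank_lt_translate:
  assumes "rank_lt k S"
  shows "rank_lt k ((\<lambda>x. x + c) ` S)"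
proof (cases k)
  case (Suc j)
  have "rank_lt (Suc (j + 0)) {x + y | x y. x \<in> S \<and> y \<in> {c}}"
    using assms unfolding Suc by (rule rank_lt_sum) (rule rank_lt_finite, simp)
  moreover have "{x + y | x y. x \<in> S \<and> y \<in> {c}} = (\<lambda>x. x + c) ` S" by auto
  ultimately show ?thesis using Suc by simp
qed (use assms in auto)

text \<open>A positive correction tending to 0 costs at most one factor \<omega>. Whatever lies
  below \<open>h a - g a\<close> has either \<open>h x < h a\<close>, which lowers the rank of the
  \<open>h\<close>-values, or \<open>g x \<ge> g a\<close>, which happens only finitely
  often.\<close>

lemma rank_lt_perturb:
  fixes h g :: "'a \<Rightarrow> real"
  assumes "rank_lt i (h ` X)" and fin: "\<And>\<eta>. \<eta> > 0 \<Longrightarrow> finite {a \<in> X. g a \<ge> \<eta>}"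
    and pos: "\<And>a. a \<in> X \<Longrightarrow> g a > 0"
  shows "rank_lt (Suc i) ((\<lambda>a. h a - g a) ` X)"
  using assms
proof (induction i arbitrary: X)
  case (Suc i)
  let ?d = "\<lambda>a. h a - g a"
  from Suc.prems(1) obtain \<P> where \<P>: "finite \<P>" "h ` X = \<Union>\<P>"
      "\<forall>P\<in>\<P>. \<forall>x\<in>P. rank_lt i (P \<inter> {..<x})" by auto
  have "rank_lt (Suc (Suc i)) (?d ` {a \<in> X. h a \<in> P})" if P: "P \<in> \<P>" for P
  proof (rule rank_lt_SucI)
    fix z assume "z \<in> ?d ` {a \<in> X. h a \<in> P}"
    then obtain a where a: "a \<in> X" "h a \<in> P" "z = ?d a" by auto
    let ?Y = "{x \<in> X. h x \<in> P \<inter> {..<h a}}" and ?Z = "{x \<in> X. g x \<ge> g a}"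
    have "rank_lt (Suc i) (?d ` ?Y)"
    proof (rule Suc.IH)
      show "rank_lt i (h ` ?Y)"
        by (rule rank_lt_subset[of _ "P \<inter> {..<h a}"]) (use \<P>(3) P a in auto)
      show "finite {x \<in> ?Y. g x \<ge> \<eta>}" if "\<eta> > 0" for \<eta>
        by (rule finite_subset[OF _ Suc.prems(2)[OF that]]) auto
    qed (use Suc.prems(3) in auto)
    moreover have "rank_lt (Suc i) (?d ` ?Z)"
      using Suc.prems a by (intro rank_lt_finite finite_imageI) auto
    ultimately have "rank_lt (Suc i) (?d ` ?Y \<union> ?d ` ?Z)" by (rule rank_lt_Un)
    moreover have "?d ` {a \<in> X. h a \<in> P} \<inter> {..<z} \<subseteq> ?d ` ?Y \<union> ?d ` ?Z"
    proof
      fix w assume "w \<in> ?d ` {a \<in> X. h a \<in> P} \<inter> {..<z}"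
      then obtain x where x: "x \<in> X" "h x \<in> P" "w = ?d x" "?d x < ?d a" using a by auto
      then have "h x < h a \<or> g x \<ge> g a" by linarith
      then show "w \<in> ?d ` ?Y \<union> ?d ` ?Z" using x by auto
    qed
    ultimately show "rank_lt (Suc i) (?d ` {a \<in> X. h a \<in> P} \<inter> {..<z})" by (rule rank_lt_subset)
  qed
  then have "rank_lt (Suc (Suc i)) (\<Union>P\<in>\<P>. ?d ` {a \<in> X. h a \<in> P})"
    by (rule rank_lt_UN[OF \<P>(1)])
  moreover have "?d ` X \<subseteq> (\<Union>P\<in>\<P>. ?d ` {a \<in> X. h a \<in> P})"
  proof
    fix z assume "z \<in> ?d ` X"
    then obtain x where "x \<in> X" "z = ?d x" by auto
    then show "z \<in> (\<Union>P\<in>\<P>. ?d ` {a \<in> X. h a \<in> P})" using \<P>(2) by blast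
  qed
  ultimately show ?case by (rule rank_lt_subset)
qed auto

text \<open>Within one piece, the part below any chosen element has smaller rank, so a least element
  exists by induction; the least of these finitely many minima serves for \<open>Q\<close>. This
  supplies the well-order that \<open>ordLess\<close> demands.\<close>

lemma rank_lt_has_least:
  "rank_lt k S \<Longrightarrow> Q \<subseteq> S \<Longrightarrow> Q \<noteq> {} \<Longrightarrow> \<exists>m\<in>Q. \<forall>y\<in>Q. m \<le> y"
proof (induction k arbitrary: S Q)
  case (Suc k)
  from Suc.prems(1) obtain \<P> where \<P>: "finite \<P>" "S = \<Union>\<P>"
      "\<forall>P\<in>\<P>. \<forall>x\<in>P. rank_lt k (P \<inter> {..<x})" by auto
  have "\<exists>m\<in>P \<inter> Q. \<forall>y\<in>P \<inter> Q. m \<le> y" if P: "P \<in> \<P>" "P \<inter> Q \<noteq> {}" for P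
  proof -
    obtain p where p: "p \<in> P" "p \<in> Q" using P(2) by auto
    show ?thesis
    proof (cases "P \<inter> Q \<inter> {..<p} = {}")
      case True
      then show ?thesis using p by (intro bexI[of _ p]) force+
    next
      case False
      moreover have "rank_lt k (P \<inter> {..<p})" using \<P>(3) P p by blast
      ultimately obtain m where "m \<in> P \<inter> Q \<inter> {..<p}" "\<forall>y\<in>P \<inter> Q \<inter> {..<p}. m \<le> y"
        using Suc.IH[of "P \<inter> {..<p}" "P \<inter> Q \<inter> {..<p}"] by blast
      then show ?thesis by (intro bexI[of _ m]) force+
    qed
  qed
  then obtain m where m: "\<And>P. P \<in> \<P> \<Longrightarrow> P \<inter> Q \<noteq> {} \<Longrightarrow> m P \<in> P \<inter> Q \<and> (\<forall>y\<in>P \<inter> Q. m P \<le> y)"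
    by metis
  let ?\<R> = "{P \<in> \<P>. P \<inter> Q \<noteq> {}}"
  have fin: "finite (m ` ?\<R>)" using \<P>(1) by simp
  have ne: "m ` ?\<R> \<noteq> {}" using Suc.prems \<P>(2) by blast
  show ?case
  proof (intro bexI ballI)
    obtain R where "R \<in> ?\<R>" "Min (m ` ?\<R>) = m R" using Min_in[OF fin ne] by (rule imageE)
    then show "Min (m ` ?\<R>) \<in> Q" using m[of R] by simp
    fix y assume "y \<in> Q"
    then obtain P where "P \<in> ?\<R>" "y \<in> P" using Suc.prems(2) \<P>(2) by blast
    then have "Min (m ` ?\<R>) \<le> m P" "m P \<le> y"
      using Min_le[OF fin imageI[of P ?\<R> m]] m[of P] \<open>y \<in> Q\<close> by auto
    then show "Min (m ` ?\<R>) \<le> y" by simp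
  qed
qed auto

section \<open>Comparison with order types\<close>

text \<open>A strictly increasing copy of \<omega>^k inside \<open>S\<close>. Its image need not be
  an initial segment, so copies can be thinned out and reassembled.\<close>

definition omega_emb :: "nat \<Rightarrow> (nat list \<Rightarrow> real) \<Rightarrow> real set \<Rightarrow> bool" where
  "omega_emb k g S \<longleftrightarrow> (\<forall>xs. length xs = k \<longrightarrow> g xs \<in> S) \<and>
     (\<forall>xs ys. length xs = k \<longrightarrow> length ys = k \<longrightarrow> (xs, ys) \<in> lex less_than \<longrightarrow> g xs < g ys)"

lemma omega_embI:
  assumes "\<And>xs. length xs = k \<Longrightarrow> g xs \<in> S"
    and "\<And>xs ys. length xs = k \<Longrightarrow> length ys = k \<Longrightarrow> (xs, ys) \<in> lex less_than \<Longrightarrow> g xs < g ys"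
  shows "omega_emb k g S"
  using assms unfolding omega_emb_def by blast

lemma omega_emb_in: "omega_emb k g S \<Longrightarrow> length xs = k \<Longrightarrow> g xs \<in> S"
  unfolding omega_emb_def by blast

lemma omega_emb_less:
  "omega_emb k g S \<Longrightarrow> length xs = k \<Longrightarrow> length ys = k \<Longrightarrow> (xs, ys) \<in> lex less_than \<Longrightarrow> g xs < g ys"
  unfolding omega_emb_def by blast

lemma omega_emb_Cons:
  assumes "omega_emb (Suc k) g S" "\<And>xs. length xs = k \<Longrightarrow> g (x # xs) \<in> T"
  shows "omega_emb k (\<lambda>xs. g (x # xs)) T"
proof (rule omega_embI)
  fix xs ys :: "nat list" assume "length xs = k" "length ys = k" "(xs, ys) \<in> lex less_than"
  then show "g (x # xs) < g (x # ys)" by (intro omega_emb_less[OF assms(1)]) simp_all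
qed (rule assms(2))

text \<open>Indecomposability of $\omega^k$: each of the $\omega$ copies of $\omega^{k-1}$ has a large
  part in \<open>A\<close> or in \<open>B\<close>, and one of the two sets is chosen infinitely often.\<close>

lemma omega_emb_Un:
  "omega_emb k g (A \<union> B) \<Longrightarrow> (\<exists>h. omega_emb k h A) \<or> (\<exists>h. omega_emb k h B)"
proof (induction k arbitrary: g A B)
  case 0
  have "omega_emb 0 g S" if "g [] \<in> S" for S using that by (intro omega_embI) simp_all
  moreover have "g [] \<in> A \<union> B" using omega_emb_in[OF 0] by simp
  ultimately show ?case by blast
next
  case (Suc k)
  \<comment> \<open>\<open>?C x\<close> is the copy of \<omega>^k with index \<open>x\<close>; later
    copies lie entirely above earlier ones.\<close>
  let ?C = "\<lambda>x. (\<lambda>xs. g (x # xs)) ` {xs. length xs = k}"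
  have C: "u < v" if "x < y" "u \<in> ?C x" "v \<in> ?C y" for x y u v
  proof -
    obtain xs ys where "u = g (x # xs)" "v = g (y # ys)" "length xs = k" "length ys = k"
      using \<open>u \<in> ?C x\<close> \<open>v \<in> ?C y\<close> by blast
    then show ?thesis using \<open>x < y\<close> by (simp add: omega_emb_less[OF Suc.prems])
  qed
  have *: "(\<exists>h. omega_emb k h (A \<inter> ?C x)) \<or> (\<exists>h. omega_emb k h (B \<inter> ?C x))" for x
  proof (rule Suc.IH)
    have "g (x # xs) \<in> A \<inter> ?C x \<union> B \<inter> ?C x" if "length xs = k" for xs
      using omega_emb_in[OF Suc.prems, of "x # xs"] that by simp
    then show "omega_emb k (\<lambda>xs. g (x # xs)) (A \<inter> ?C x \<union> B \<inter> ?C x)"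
      by (rule omega_emb_Cons[OF Suc.prems])
  qed
  have copies: "\<exists>h. omega_emb (Suc k) h T" if inf: "infinite {x. \<exists>h. omega_emb k h (T \<inter> ?C x)}" for T
  proof -
    \<comment> \<open>The infinitely many usable copies, renumbered increasingly, form a copy of
      \<omega>^(k+1).\<close>
    define e where "e = enumerate {x. \<exists>h. omega_emb k h (T \<inter> ?C x)}"
    have "\<exists>h. omega_emb k h (T \<inter> ?C (e x))" for x
      using enumerate_in_set[OF inf, of x] unfolding e_def mem_Collect_eq .
    then obtain h where h: "omega_emb k (h x) (T \<inter> ?C (e x))" for x
      using choice[of "\<lambda>x h. omega_emb k h (T \<inter> ?C (e x))"] by auto
    have mono: "e x < e y" if "x < y" for x y
      using enumerate_mono[OF that inf] by (simp add: e_def)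
    have "omega_emb (Suc k) (\<lambda>xs. h (hd xs) (tl xs)) T"
    proof (rule omega_embI)
      fix xs :: "nat list" assume "length xs = Suc k"
      then show "h (hd xs) (tl xs) \<in> T" using omega_emb_in[OF h, of "tl xs" "hd xs"] by simp
    next
      fix xs ys :: "nat list"
      assume len: "length xs = Suc k" "length ys = Suc k" and lt: "(xs, ys) \<in> lex less_than"
      obtain x xs' where x: "xs = x # xs'" "length xs' = k" using len(1) by (cases xs) auto
      obtain y ys' where y: "ys = y # ys'" "length ys' = k" using len(2) by (cases ys) auto
      consider "x < y" | "x = y" "(xs', ys') \<in> lex less_than"
        using lt unfolding x y Cons_in_lex by auto
      then have "h x xs' < h y ys'"
      proof cases
        case 1
        show ?thesis
          by (rule C[OF mono[OF 1]]) (use omega_emb_in[OF h[of x] x(2)] omega_emb_in[OF h[of y] y(2)] in simp_all)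
      next
        case 2
        then show ?thesis using omega_emb_less[OF h[of x] x(2) y(2)] by simp
      qed
      then show "h (hd xs) (tl xs) < h (hd ys) (tl ys)" by (simp add: x y)
    qed
    then show ?thesis by blast
  qed
  have "{x. \<exists>h. omega_emb k h (A \<inter> ?C x)} \<union> {x. \<exists>h. omega_emb k h (B \<inter> ?C x)} = UNIV"
    using * by blast
  then have "infinite ({x. \<exists>h. omega_emb k h (A \<inter> ?C x)} \<union> {x. \<exists>h. omega_emb k h (B \<inter> ?C x)})"
    using infinite_UNIV_nat by simp
  then have "infinite {x. \<exists>h. omega_emb k h (A \<inter> ?C x)} \<or> infinite {x. \<exists>h. omega_emb k h (B \<inter> ?C x)}"
    unfolding finite_Un by blast
  then show ?case using copies by blast
qed

lemma omega_emb_Union: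
  assumes "finite \<F>" "omega_emb k g (\<Union>\<F>)"
  shows "\<exists>S\<in>\<F>. \<exists>h. omega_emb k h S"
  using assms
proof (induction \<F> arbitrary: g rule: finite_induct)
  case empty
  then show ?case using omega_emb_in[of k g "{}" "replicate k 0"] by simp
next
  case (insert S \<F>)
  then have "(\<exists>h. omega_emb k h S) \<or> (\<exists>h. omega_emb k h (\<Union>\<F>))"
    by (intro omega_emb_Un) simp
  then show ?case using insert.IH by blast
qed

text \<open>By indecomposability a single piece would contain a copy of \<omega>^(k+1). Its first
  copy of \<omega>^k lies below the first element of the second one, hence in an initial segment of
  too small a rank.\<close>

lemma rank_lt_no_omega_emb: "rank_lt k S \<Longrightarrow> \<not> omega_emb k g S"
proof (induction k arbitrary: S g)
  case (Suc k)
  from Suc.prems(1) obtain \<P> where \<P>: "finite \<P>" "S = \<Union>\<P>"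
      "\<forall>P\<in>\<P>. \<forall>x\<in>P. rank_lt k (P \<inter> {..<x})" by auto
  show ?case
  proof
    assume "omega_emb (Suc k) g S"
    then obtain P h where P: "P \<in> \<P>" "omega_emb (Suc k) h P"
      using omega_emb_Union[OF \<P>(1)] \<P>(2) by blast
    let ?x = "h (1 # replicate k 0)"
    have "?x \<in> P" by (rule omega_emb_in[OF P(2)]) simp
    have "h (0 # xs) \<in> P \<inter> {..<?x}" if "length xs = k" for xs
      using omega_emb_in[OF P(2), of "0 # xs"] omega_emb_less[OF P(2), of "0 # xs" "1 # replicate k 0"] that
      by simp
    then have "omega_emb k (\<lambda>xs. h (0 # xs)) (P \<inter> {..<?x})" by (rule omega_emb_Cons[OF P(2)])
    then show False using Suc.IH \<P>(3) P(1) \<open>?x \<in> P\<close> by blast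
  qed
qed (auto dest: omega_emb_in[of 0 _ _ "[]"])

text \<open>Heads are at most the head of \<open>l\<close>, so splitting by the head gives finitely
  many pieces. Below \<open>x\<close> in its piece, the tails are bounded by the tail of
  \<open>f x\<close>, and the induction applies.\<close>

lemma rank_lt_of_lex_bound:
  assumes "\<And>x. x \<in> S \<Longrightarrow> length (f x) = k \<and> (f x, l) \<in> lex less_than" "length l = k"
    and "\<And>x y. x \<in> S \<Longrightarrow> y \<in> S \<Longrightarrow> x < y \<Longrightarrow> (f x, f y) \<in> lex less_than"
  shows "rank_lt k S"
  using assms
proof (induction k arbitrary: S f l)
  case 0
  then show ?case by fastforce
next
  case (Suc k)
  let ?P = "\<lambda>h. {x \<in> S. hd (f x) = h}"
  have f: "f x = hd (f x) # tl (f x)" if "x \<in> S" for x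
    using Suc.prems(1)[OF that] by (cases "f x") auto
  obtain m l' where l: "l = m # l'" using Suc.prems(2) by (cases l) auto
  have "rank_lt (Suc k) (?P h)" for h
  proof (rule rank_lt_SucI)
    fix x assume x: "x \<in> ?P h"
    have lt: "(tl (f u), tl (f v)) \<in> lex less_than" if "u \<in> ?P h" "v \<in> ?P h" "u < v" for u v
    proof -
      have "(hd (f u) # tl (f u), hd (f v) # tl (f v)) \<in> lex less_than"
        using Suc.prems(3)[of u v] that f[of u] f[of v] by simp
      then show ?thesis using that by simp
    qed
    show "rank_lt k (?P h \<inter> {..<x})"
      using x lt Suc.prems(1) by (intro Suc.IH[of _ "\<lambda>u. tl (f u)" "tl (f x)"]) auto
  qed
  then have "rank_lt (Suc k) (\<Union>h\<in>{..m}. ?P h)" by (intro rank_lt_UN) auto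
  moreover have "S \<subseteq> (\<Union>h\<in>{..m}. ?P h)"
  proof
    fix x assume x: "x \<in> S"
    then have "(hd (f x) # tl (f x), m # l') \<in> lex less_than" using Suc.prems(1) f l by metis
    then show "x \<in> (\<Union>h\<in>{..m}. ?P h)" using x by auto
  qed
  ultimately show ?case by (rule rank_lt_subset)
qed

lemma ord_type_iff: "(x, y) \<in> ord_type S \<longleftrightarrow> x \<in> S \<and> y \<in> S \<and> x \<le> y"
  by (auto simp: ord_type_def relation_of_def)

lemma Field_ord_type: "Field (ord_type S) = S"
proof (intro set_eqI iffI)
  fix x assume "x \<in> S"
  then have "(x, x) \<in> ord_type S" by (simp add: ord_type_iff)
  then show "x \<in> Field (ord_type S)" by (rule FieldI1)
next
  fix x assume "x \<in> Field (ord_type S)"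
  then show "x \<in> S" unfolding Field_def by (auto simp add: ord_type_def relation_of_def)
qed

lemma Well_order_ord_type:
  assumes "\<And>Q. Q \<subseteq> S \<Longrightarrow> Q \<noteq> {} \<Longrightarrow> \<exists>m\<in>Q. \<forall>y\<in>Q. m \<le> y"
  shows "Well_order (ord_type S)"
proof -
  have "wf (ord_type S - Id)"
  proof (rule wfI_min)
    fix x and Q :: "real set" assume x: "x \<in> Q"
    show "\<exists>z\<in>Q. \<forall>y. (y, z) \<in> ord_type S - Id \<longrightarrow> y \<notin> Q"
    proof (cases "Q \<inter> S = {}")
      case True
      then show ?thesis using x by (auto simp: ord_type_iff)
    next
      case False
      then obtain m where m: "m \<in> Q \<inter> S" "\<forall>y\<in>Q \<inter> S. m \<le> y" using assms[of "Q \<inter> S"] by blast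
      have "y \<notin> Q" if "(y, m) \<in> ord_type S - Id" for y
      proof
        assume "y \<in> Q"
        then have "m \<le> y" "y \<le> m" using that m by (auto simp: ord_type_iff)
        then show False using that by simp
      qed
      then show ?thesis using m(1) by blast
    qed
  qed
  moreover have "refl_on S (ord_type S)" "trans (ord_type S)" "antisym (ord_type S)" "total_on S (ord_type S)"
    by (rule refl_onI transI antisymI total_onI; auto simp: ord_type_iff)+
  ultimately show ?thesis
    unfolding well_order_on_def linear_order_on_def partial_order_on_def preorder_on_def Field_ord_type
    by (auto simp: ord_type_iff)
qed

text \<open>A smaller order type is isomorphic to the part of \<omega>^k below some list
  \<open>l\<close>, which gives a lexicographic bound. Conversely, if the type is not smaller, then
  \<omega>^k embeds into \<open>S\<close>, which the rank forbids.\<close>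

lemma ordLess_omega_pow_iff:
  "(ord_type S, omega_pow k) \<in> ordLess \<longleftrightarrow> rank_lt k S"
proof
  assume less: "(ord_type S, omega_pow k) \<in> ordLess"
  then have wo: "Well_order (ord_type S)" unfolding ordLess_def by blast
  obtain l where l: "l \<in> Field (omega_pow k)"
      "(ord_type S, Restr (omega_pow k) (underS (omega_pow k) l)) \<in> ordIso"
    using less ordLess_iff_ordIso_Restr[OF Well_order_omega_pow wo] by blast
  let ?R = "Restr (omega_pow k) (underS (omega_pow k) l)"
  obtain f where f: "iso (ord_type S) ?R f" using l(2) unfolding ordIso_def by blast
  have bij: "bij_betw f S (Field ?R)"
    and iff: "\<forall>x\<in>S. \<forall>y\<in>S. (x, y) \<in> ord_type S \<longleftrightarrow> (f x, f y) \<in> ?R"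
    using f unfolding iso_iff2 Field_ord_type by blast+
  have fst: "(f x, f y) \<in> ?R" if "x \<in> S" "y \<in> S" "x \<le> y" for x y
    using iff that ord_type_iff by blast
  have inj: "inj_on f S" using bij by (rule bij_betw_imp_inj_on)
  show "rank_lt k S"
  proof (rule rank_lt_of_lex_bound)
    show "length l = k" using l(1) by (simp add: Field_omega_pow)
    fix x assume "x \<in> S"
    then have "f x \<in> underS (omega_pow k) l" using fst[of x x] by auto
    then show "length (f x) = k \<and> (f x, l) \<in> lex less_than"
      by (auto simp: underS_def omega_pow_lex)
  next
    fix x y assume "x \<in> S" "y \<in> S" "x < y"
    then have "(f x, f y) \<in> omega_pow k" "f x \<noteq> f y"
      using fst[of x y] inj by (auto simp: inj_on_def)
    then show "(f x, f y) \<in> lex less_than" by (simp add: omega_pow_lex)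
  qed
next
  assume S: "rank_lt k S"
  have wo: "Well_order (ord_type S)"
    using rank_lt_has_least[OF S] by (rule Well_order_ord_type)
  show "(ord_type S, omega_pow k) \<in> ordLess"
  proof (rule ccontr)
    assume "(ord_type S, omega_pow k) \<notin> ordLess"
    then have "(omega_pow k, ord_type S) \<in> ordLeq"
      using not_ordLess_iff_ordLeq[OF Well_order_omega_pow wo] by blast
    then obtain f where f: "embed (omega_pow k) (ord_type S) f" unfolding ordLeq_def by blast
    have comp: "compat (omega_pow k) (ord_type S) f" and inj: "inj_on f (Field (omega_pow k))"
      using embed_compat[OF f] embed_inj_on[OF Well_order_omega_pow f] by auto
    have "omega_emb k f S"
    proof (rule omega_embI)
      fix xs :: "nat list" assume "length xs = k"
      then show "f xs \<in> S"
        using comp[unfolded compat_def, rule_format, of xs xs] by (simp add: omega_pow_lex ord_type_iff)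
    next
      fix xs ys :: "nat list"
      assume a: "length xs = k" "length ys = k" "(xs, ys) \<in> lex less_than"
      then have "f xs \<le> f ys"
        using comp[unfolded compat_def, rule_format, of xs ys] by (simp add: omega_pow_lex ord_type_iff)
      moreover have "xs \<noteq> ys"
        using a wf_not_refl[OF wf_lex[OF wf_less_than]] by blast
      then have "f xs \<noteq> f ys" using inj a by (auto simp: inj_on_def Field_omega_pow)
      ultimately show "f xs < f ys" by simp
    qed
    then show False using rank_lt_no_omega_emb[OF S] by blast
  qed
qed

section \<open>Least defects and thresholds\<close>

text \<open>From \<open>3 < 2 ^ 2\<close> and \<open>2 ^ 3 < 3 ^ 2\<close>. These bounds suffice for
  all comparisons of class minima.\<close>

lemma log_3_2: "1 / 2 < log 3 (2::real)" "log 3 (2::real) < 2 / 3"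
proof -
  have "log 3 3 < log 3 ((2::real) ^ 2)" by (subst log_less_cancel_iff) auto
  then have "1 < 2 * log 3 (2::real)" by (subst (asm) log_nat_power) auto
  then show "1 / 2 < log 3 (2::real)" by simp
  have "log 3 ((2::real) ^ 3) < log 3 (3 ^ 2)" by (subst log_less_cancel_iff) auto
  then have "3 * log 3 (2::real) < 2 * log 3 3" by (subst (asm) (1 2) log_nat_power) auto
  then show "log 3 (2::real) < 2 / 3" by simp
qed

lemma log_3_4: "log 3 (4::real) = 2 * log 3 2"
  using log_nat_power[of "2::real" 3 2] by simp

text \<open>The least defects of the classes are $\delta(3) = 0$, $\delta(4)$ and $\delta(2)$; note that
  $\delta(1) = 1$ is not the least one of its class.\<close>

definition class_min :: "int \<Rightarrow> real" where
  "class_min a = (if a mod 3 = 0 then 0 else if a mod 3 = 1 then 4 - 6 * log 3 2 else 2 - 3 * log 3 2)"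

lemma class_min_cong: "[a = b] (mod 3) \<Longrightarrow> class_min a = class_min b"
  by (simp add: class_min_def cong_def)

lemma class_min_nonneg: "0 \<le> class_min a" and class_min_less_1: "class_min a < 1"
  using log_3_2 by (auto simp: class_min_def)

text \<open>A check of residues: 2 + 2 is an equality, as 4 is the product of 2 and 2, and 1 + 1
  rests on \<open>log 3 2 < 2 / 3\<close>.\<close>

lemma class_min_add: "class_min (a + b) \<le> class_min a + class_min b"
proof -
  define r s where "r = a mod 3" and "s = b mod 3"
  have eq: "class_min a = class_min r" "class_min b = class_min s" "class_min (a + b) = class_min (r + s)"
    by (rule class_min_cong; simp add: r_def s_def cong_def mod_add_eq)+
  have "r = 0 \<or> r = 1 \<or> r = 2" "s = 0 \<or> s = 1 \<or> s = 2"
    unfolding r_def s_def by presburger+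
  then have "class_min (r + s) \<le> class_min r + class_min s"
    using log_3_2 by (elim disjE; simp add: class_min_def)
  then show ?thesis by (simp only: eq)
qed

text \<open>For $c = \|n\|$ and $c - k \ge 2$ this is $c - 3 \log_3 E(c - k)$, so that $D(n) \le k$ if and only
  if $\delta(n)$ is at most the threshold.\<close>

definition threshold :: "int \<Rightarrow> nat \<Rightarrow> real" where
  "threshold a k = real k + class_min (a - int k)"

lemma threshold_less: "j < k \<Longrightarrow> threshold a j < threshold a k"
  using class_min_less_1[of "a - int j"] class_min_nonneg[of "a - int k"]
  unfolding threshold_def by linarith

lemma threshold_less_iff: "threshold a j < threshold a k \<longleftrightarrow> j < k"
  using threshold_less[of j k a] threshold_less[of k j a] by (cases j k rule: linorder_cases) auto

lemma threshold_add: "threshold (a + b) (i + j) \<le> threshold a i + threshold b j"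
  using class_min_add[of "a - int i" "b - int j"] by (simp add: threshold_def algebra_simps)

text \<open>Splitting off a summand of complexity \<open>c\<close> lowers the exponent by one. For
  \<open>c = 1\<close> this is an equality; for larger \<open>c\<close> the integer loss outweighs
  any difference of class minima.\<close>

lemma threshold_shift:
  assumes "c \<ge> 1"
  shows "threshold a (Suc k) - real c \<le> threshold (a - int c) k"
proof (cases "c = 1")
  case True
  then show ?thesis by (simp add: threshold_def algebra_simps)
next
  case False
  then show ?thesis
    using assms class_min_less_1[of "a - int (Suc k)"] class_min_nonneg[of "a - int c - int k"]
    unfolding threshold_def by simp
qed

text \<open>The margin \<open>\<eta>\<close> keeps \<open>s\<close> strictly below the upper
  threshold, as the bound on ranks requires, at the price of an error \<open>\<eta>\<close> at the
  lower one.\<close>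

lemma between_thresholds:
  assumes "class_min a \<le> s" "\<eta> > 0"
  obtains i where "s \<le> threshold a (Suc i) - \<eta>" "threshold a i - \<eta> < s"
proof -
  define P where "P k \<longleftrightarrow> s \<le> threshold a k - \<eta>" for k
  obtain k where "s + \<eta> \<le> real k" using real_arch_simple by blast
  then have "P k" unfolding P_def threshold_def using class_min_nonneg[of "a - int k"] by linarith
  then have L: "P (LEAST k. P k)" by (rule LeastI)
  \<comment> \<open>\<open>threshold a 0\<close> is \<open>class_min a\<close>, so the least
    \<open>k\<close> is positive and has a predecessor.\<close>
  have "\<not> P 0" using assms by (simp add: P_def threshold_def)
  then obtain i where i: "(LEAST k. P k) = Suc i" using L by (cases "LEAST k. P k") auto
  then have "\<not> P i" using not_less_Least[of i P] by simp
  then show thesis using that[of i] L i by (auto simp: P_def)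
qed

section \<open>Class minima as lower bounds for defects\<close>

lemma Eform_pos: "k \<ge> 1 \<Longrightarrow> Eform k > 0"
  using Eform_ge[of k] by linarith

text \<open>Raising \<open>k\<close> by 3 multiplies \<open>Eform k\<close> by 3, so only
  \<open>k = 2, 3, 4\<close> need a computation. At \<open>k = 1\<close> the left side is 1, above
  the class minimum.\<close>

lemma Eform_log:
  "k \<ge> 2 \<Longrightarrow> real k - 3 * log 3 (real (Eform k)) = class_min (int k)"
proof (induction k rule: less_induct)
  case (less k)
  show ?case
  proof (cases "k \<ge> 5")
    case True
    define j where "j = k - 3"
    have j: "k = j + 3" "j \<ge> 2" "j < k" using True by (auto simp: j_def)
    have "log 3 (real (Eform k)) = 1 + log 3 (real (Eform j))"
      using Eform_add3[OF j(2)] Eform_pos[of j] j by (simp add: log_mult)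
    moreover have "class_min (int k) = class_min (int j)"
      by (rule class_min_cong) (simp add: j(1) cong_def)
    ultimately show ?thesis using less.IH[OF j(3,2)] j(1) by simp
  next
    case False
    then have "k = 2 \<or> k = 3 \<or> k = 4" using less.prems by auto
    then show ?thesis by (auto simp: class_min_def numeral_eq_Suc log_3_4[simplified])
  qed
qed

lemma class_min_le_Eform:
  assumes "k \<ge> 1"
  shows "class_min (int k) \<le> real k - 3 * log 3 (real (Eform k))"
proof (cases "k = 1")
  case True
  then show ?thesis using class_min_less_1[of 1] by simp
next
  case False
  then show ?thesis using Eform_log[of k] assms by simp
qed

lemma class_min_le_defect:
  assumes "n > 0"
  shows "class_min (int (cpx n)) \<le> defect n"
proof -
  have "log 3 (real n) \<le> log 3 (real (Eform (cpx n)))"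
    using le_Eform_cpx[OF assms] assms by (subst log_le_cancel_iff) auto
  then show ?thesis using class_min_le_Eform[OF cpx_pos[OF assms]] by (simp add: defect_def)
qed

lemma defect_nonneg: "n > 0 \<Longrightarrow> 0 \<le> defect n"
  using class_min_le_defect class_min_nonneg order_trans by blast

section \<open>Optimal sums and products, and the gap above defect 0\<close>

text \<open>The cases are the outermost operation of an optimal expression. A factor 1 cannot occur,
  since it would waste a one.\<close>

lemma cpx_cases:
  assumes "n > 1"
  obtains (add) u v where "0 < v" "v \<le> u" "n = u + v" "cpx n = cpx u + cpx v"
  | (mult) u v where "1 < u" "1 < v" "n = u * v" "cpx n = cpx u + cpx v"
proof -
  obtain e where e: "expr_val e = n" "expr_ones e = cpx n" using cpx_attained assms by (metis less_trans zero_less_one)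
  have pos: "expr_val e > 0" for e by (induction e) auto
  show thesis
  proof (cases e)
    case EOne
    then show ?thesis using e assms by simp
  next
    case (EAdd a b)
    \<comment> \<open>Replacing both subexpressions by optimal ones cannot save anything, so they
      were optimal already.\<close>
    obtain a' where a': "expr_val a' = expr_val a" "expr_ones a' = cpx (expr_val a)"
      using cpx_attained[OF pos] by blast
    obtain b' where b': "expr_val b' = expr_val b" "expr_ones b' = cpx (expr_val b)"
      using cpx_attained[OF pos] by blast
    have "cpx n = cpx (expr_val a) + cpx (expr_val b)"
      using cpx_le[of a] cpx_le[of b] cpx_le[of "EAdd a' b'"] a' b' e EAdd by auto
    then show ?thesis
      using add[of "expr_val b" "expr_val a"] add[of "expr_val a" "expr_val b"] pos e EAdd
      by (cases "expr_val b \<le> expr_val a") (auto simp: add.commute)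
  next
    case (EMul a b)
    obtain a' where a': "expr_val a' = expr_val a" "expr_ones a' = cpx (expr_val a)"
      using cpx_attained[OF pos] by blast
    obtain b' where b': "expr_val b' = expr_val b" "expr_ones b' = cpx (expr_val b)"
      using cpx_attained[OF pos] by blast
    have c: "cpx n = cpx (expr_val a) + cpx (expr_val b)"
      using cpx_le[of a] cpx_le[of b] cpx_le[of "EMul a' b'"] a' b' e EMul by auto
    have "expr_val a \<noteq> 1" "expr_val b \<noteq> 1"
      using c e EMul cpx_pos[of 1] by auto
    then have "expr_val a > 1" "expr_val b > 1" using pos[of a] pos[of b] by linarith+
    then show ?thesis using mult[of "expr_val a" "expr_val b"] c e EMul by simp
  qed
qed

lemma defect_mult:
  assumes "u > 0" "v > 0" "cpx (u * v) = cpx u + cpx v"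
  shows "defect (u * v) = defect u + defect v"
  using assms by (simp add: defect_def log_mult)

lemma defect_add:
  assumes "u > 0" "cpx (u + v) = cpx u + cpx v"
  shows "defect (u + v) = defect u + real (cpx v) - 3 * log 3 (1 + real v / real u)"
proof -
  have "real (u + v) = real u * (1 + real v / real u)" using assms by (simp add: distrib_left)
  then have "log 3 (real (u + v)) = log 3 (real u * (1 + real v / real u))" by (rule arg_cong)
  also have "\<dots> = log 3 (real u) + log 3 (1 + real v / real u)"
    using assms by (intro log_mult_pos) (auto intro: add_pos_nonneg)
  finally show ?thesis using assms by (simp add: defect_def)
qed

lemma Eform_values:
  "Eform 1 = 1" "Eform 2 = 2" "Eform 3 = 3" "Eform 4 = 4" "Eform 5 = 6" "Eform 6 = 9" "Eform 7 = 12" "Eform 8 = 18"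
  by (simp_all add: numeral_eq_Suc)

text \<open>A number that is optimally a sum falls short of \<open>E\<close> by a constant factor.
  The ratio 8/9 is chosen because \<open>- log 3 (8 / 9)\<close> equals \<open>class_min 2\<close>.
  Totals 6 to 8 are checked directly; from 9 on, taking 3 off an argument that is at least 5 keeps
  the total at least 6.\<close>

lemma Eform_sum_le: "p \<ge> 1 \<Longrightarrow> q \<ge> 1 \<Longrightarrow> p + q \<ge> 6 \<Longrightarrow> 9 * (Eform p + Eform q) \<le> 8 * Eform (p + q)"
proof (induction "p + q" arbitrary: p q rule: less_induct)
  case less
  show ?case
  proof (cases "p + q \<ge> 9")
    case True
    have *: "9 * (Eform c + Eform d) \<le> 8 * Eform (c + d)"
      if "c + d = p + q" "c \<ge> 5" "d \<ge> 1" for c d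
    proof -
      have "9 * (Eform (c - 3) + Eform d) \<le> 8 * Eform (c - 3 + d)"
        using that True by (intro less) auto
      moreover have "Eform c = 3 * Eform (c - 3)"
        using Eform_add3[of "c - 3"] that by simp
      moreover have "Eform (c + d) = 3 * Eform (c - 3 + d)"
        using Eform_add3[of "c - 3 + d"] that by simp
      ultimately show ?thesis by simp
    qed
    have "p \<ge> 5 \<or> q \<ge> 5" using True by linarith
    then show ?thesis using *[of p q] *[of q p] less.prems by (auto simp: add.commute)
  next
    case False
    then have "p = 1 \<or> p = 2 \<or> p = 3 \<or> p = 4 \<or> p = 5 \<or> p = 6 \<or> p = 7"
      "q = 6 - p \<or> q = 7 - p \<or> q = 8 - p"
      using less.prems by linarith+
    then show ?thesis using less.prems(1,2) by (elim disjE; simp add: Eform_values)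
  qed
qed

text \<open>\<open>class_min 2\<close> is the smallest positive class minimum, so the complexity is
  divisible by 3. Factors of a product inherit the small defect, and a sum of complexity at least 6
  has defect at least \<open>3 * class_min 2\<close>; complexity 3 leaves only
  \<open>n = 3\<close>.\<close>

lemma defect_less_gap:
  assumes "n > 0" "defect n < class_min 2"
  shows "\<exists>j\<ge>1. n = 3 ^ j \<and> cpx n = 3 * j"
  using assms
proof (induction n rule: less_induct)
  case (less n)
  have gap: "class_min 2 = 2 - 3 * log 3 2" "class_min 2 > 0" using log_3_2 by (auto simp: class_min_def)
  have "class_min (int (cpx n)) < class_min 2"
    using class_min_le_defect[OF less.prems(1)] less.prems(2) by (rule le_less_trans)
  then have "int (cpx n) mod 3 = 0" using log_3_2 by (auto simp: class_min_def split: if_splits)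
  then have "3 dvd cpx n" by presburger
  then obtain j where j: "cpx n = 3 * j" by (rule dvdE)
  have "j \<ge> 1" using j cpx_pos[OF less.prems(1)] by simp
  have "n \<noteq> 1"
    using less.prems(2) cpx_pos[of 1] class_min_less_1[of 2] by (auto simp: defect_def)
  then have "n > 1" using less.prems(1) by simp
  then show ?case
  proof (cases rule: cpx_cases)
    case (mult u v)
    then have "defect n = defect u + defect v" using defect_mult[of u v] by simp
    moreover have "defect u \<ge> 0" "defect v \<ge> 0" using mult by (auto intro: defect_nonneg)
    ultimately have "defect u < class_min 2" "defect v < class_min 2" using less.prems by auto
    moreover have "u < n" "v < n" using mult by auto
    ultimately obtain i l where "u = 3 ^ i" "cpx u = 3 * i" "v = 3 ^ l" "cpx v = 3 * l"
      using less.IH[of u] less.IH[of v] mult by auto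
    then have "n = 3 ^ (i + l)" "i + l = j" using mult j by (auto simp: power_add)
    then show ?thesis using j \<open>j \<ge> 1\<close> by blast
  next
    case (add u v)
    show ?thesis
    proof (cases "j = 1")
      case True
      then have "n \<le> 3" using le_Eform_cpx[OF less.prems(1)] j by (simp add: numeral_eq_Suc)
      moreover have "n \<noteq> 2" using less.prems(2) j True gap by (auto simp: defect_def)
      ultimately show ?thesis using \<open>n > 1\<close> j True by (intro exI[of _ 1]) auto
    next
      case False
      have pos: "u > 0" "v > 0" using add by auto
      have "9 * n \<le> 9 * (Eform (cpx u) + Eform (cpx v))"
        using le_Eform_cpx[OF pos(1)] le_Eform_cpx[OF pos(2)] add by simp
      also have "\<dots> \<le> 8 * Eform (cpx u + cpx v)"
        using cpx_pos[OF pos(1)] cpx_pos[OF pos(2)] add j False \<open>j \<ge> 1\<close> by (intro Eform_sum_le) auto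
      also have "\<dots> = 8 * 3 ^ j" using add j Eform_3[OF \<open>j \<ge> 1\<close>] by simp
      finally have "real (9 * n) \<le> real (8 * 3 ^ j)" by (subst of_nat_le_iff)
      then have "3 ^ 2 * real n \<le> 2 ^ 3 * 3 ^ j" by simp
      then have "log 3 (3 ^ 2 * real n) \<le> log 3 (2 ^ 3 * 3 ^ j)"
        using less.prems(1) by (subst log_le_cancel_iff) auto
      moreover have "log 3 (3 ^ 2 * real n) = 2 + log 3 (real n)"
        using less.prems(1) log_nat_power[of "3::real" 3 2] by (subst log_mult_pos) simp_all
      moreover have "log 3 (2 ^ 3 * 3 ^ j) = 3 * log 3 (2::real) + real j"
        using log_nat_power[of "2::real" 3 3] by (subst log_mult_pos) (simp_all add: log_nat_power)
      ultimately have "3 * class_min 2 \<le> defect n" using j gap by (simp add: defect_def)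
      then show ?thesis using less.prems(2) gap by linarith
    qed
  qed
qed

section \<open>Upper bound\<close>

definition all_defects :: "int \<Rightarrow> real set" where
  "all_defects a = {defect n | n. n > 0 \<and> [int (cpx n) = a] (mod 3)}"

lemma class_min_le_all_defects:
  assumes "d \<in> all_defects a"
  shows "class_min a \<le> d"
proof -
  obtain n where "n > 0" "[int (cpx n) = a] (mod 3)" "d = defect n"
    using assms by (auto simp: all_defects_def)
  then show ?thesis using class_min_le_defect[of n] class_min_cong[of "int (cpx n)" a] by simp
qed

text \<open>For fixed \<open>v\<close> the logarithmic correction tends to 0 as \<open>u\<close>
  grows, which is what \<open>rank_lt_perturb\<close> asks for.\<close>

lemma finite_log_ratio_ge:
  assumes "\<eta> > 0" "v > 0"
  shows "finite {u::nat. u > 0 \<and> 3 * log 3 (1 + real v / real u) \<ge> \<eta>}"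
proof -
  define t where "t = 3 powr (\<eta> / 3)"
  have t: "t > 1" using assms(1) by (simp add: t_def)
  have "real u \<le> real v / (t - 1)" if u: "u > 0" "3 * log 3 (1 + real v / real u) \<ge> \<eta>" for u :: nat
  proof -
    have "1 + real v / real u > 0" by (intro add_pos_nonneg) auto
    moreover have "\<eta> / 3 \<le> log 3 (1 + real v / real u)" using u(2) by simp
    ultimately have "t \<le> 1 + real v / real u" unfolding t_def by (subst (asm) le_log_iff) auto
    then have "t - 1 \<le> real v / real u" by simp
    then have "(t - 1) * real u \<le> real v" using u(1) by (simp add: pos_le_divide_eq)
    then show ?thesis using t by (simp add: pos_le_divide_eq mult.commute)
  qed
  then have "{u::nat. u > 0 \<and> 3 * log 3 (1 + real v / real u) \<ge> \<eta>} \<subseteq> {..nat \<lfloor>real v / (t - 1)\<rfloor>}"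
    using le_nat_floor by blast
  then show ?thesis by (rule finite_subset) simp
qed

text \<open>The smaller summand \<open>v\<close> is fixed. The defects of the sums are those of
  \<open>u\<close>, translated by the complexity of \<open>v\<close> and perturbed by a correction
  tending to 0.\<close>

lemma rank_lt_sums:
  assumes v: "v > 0" and "\<eta> > 0"
    and IH: "rank_lt k (all_defects (a - int (cpx v)) \<inter> {..x - real (cpx v) + \<eta>})"
  shows "rank_lt (Suc k) {defect (u + v) | u. u \<ge> v \<and> cpx (u + v) = cpx u + cpx v \<and>
           [int (cpx (u + v)) = a] (mod 3) \<and> defect (u + v) \<le> x}" (is "rank_lt _ ?S")
proof -
  define X where "X = {u. u > 0 \<and> [int (cpx u) = a - int (cpx v)] (mod 3) \<and> defect u \<le> x - real (cpx v) + \<eta>}"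
  let ?h = "\<lambda>u. defect u + real (cpx v)" and ?g = "\<lambda>u. 3 * log 3 (1 + real v / real u)"
  \<comment> \<open>Outside the finite set \<open>?F\<close> the correction is below
    \<open>\<eta>\<close>, which puts \<open>u\<close> into \<open>X\<close>.\<close>
  let ?F = "{u. u > 0 \<and> ?g u \<ge> \<eta>}"
  have "rank_lt (Suc k) ((\<lambda>u. ?h u - ?g u) ` X)"
  proof (rule rank_lt_perturb)
    have "?h ` X \<subseteq> (\<lambda>t. t + real (cpx v)) ` (all_defects (a - int (cpx v)) \<inter> {..x - real (cpx v) + \<eta>})"
      by (auto simp: X_def all_defects_def)
    then show "rank_lt k (?h ` X)" by (rule rank_lt_subset[OF rank_lt_translate[OF IH]])
    show "finite {u \<in> X. ?g u \<ge> \<theta>}" if "\<theta> > 0" for \<theta>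
      by (rule finite_subset[OF _ finite_log_ratio_ge[OF that v]]) (auto simp: X_def)
    show "?g u > 0" if "u \<in> X" for u
    proof -
      have "0 < real v / real u" using that v by (simp add: X_def)
      then show ?thesis by (simp add: zero_less_log_cancel_iff)
    qed
  qed
  moreover have "rank_lt (Suc k) ((\<lambda>u. defect (u + v)) ` ?F)"
    by (intro rank_lt_finite finite_imageI finite_log_ratio_ge assms)
  ultimately have "rank_lt (Suc k) ((\<lambda>u. ?h u - ?g u) ` X \<union> (\<lambda>u. defect (u + v)) ` ?F)"
    by (rule rank_lt_Un)
  moreover have "?S \<subseteq> (\<lambda>u. ?h u - ?g u) ` X \<union> (\<lambda>u. defect (u + v)) ` ?F"
  proof
    fix d assume "d \<in> ?S"
    then obtain u where u: "d = defect (u + v)" "u \<ge> v" "cpx (u + v) = cpx u + cpx v"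
        "[int (cpx (u + v)) = a] (mod 3)" "defect (u + v) \<le> x" by blast
    have "u > 0" using u v by simp
    have d: "d = ?h u - ?g u" using defect_add[OF \<open>u > 0\<close> u(3)] u(1) by simp
    show "d \<in> (\<lambda>u. ?h u - ?g u) ` X \<union> (\<lambda>u. defect (u + v)) ` ?F"
    proof (cases "?g u \<ge> \<eta>")
      case True
      then show ?thesis using u(1) \<open>u > 0\<close> by blast
    next
      case False
      have "[int (cpx u) = a - int (cpx v)] (mod 3)"
        using u(4) unfolding u(3) cong_iff_dvd_diff by (simp add: algebra_simps)
      then have "u \<in> X" using False d u(1,5) \<open>u > 0\<close> by (simp add: X_def)
      then show ?thesis using d by blast
    qed
  qed
  ultimately show ?thesis by (rule rank_lt_subset)
qed

text \<open>A pair \<open>s, t\<close> lying just above the thresholds \<open>i, j\<close> has its sum above the threshold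
  \<open>i + j\<close> up to an arbitrarily small error, hence \<open>i + j \<le> k\<close>.\<close>

lemma rank_lt_products:
  assumes x: "x < threshold a (Suc k)" and "g > 0"
    and IH: "\<And>y b i. y \<le> x - g \<Longrightarrow> y < threshold b i \<Longrightarrow> rank_lt i (all_defects b \<inter> {..y})"
  shows "rank_lt (Suc k) {s + t | s t b. s \<in> all_defects b \<and> t \<in> all_defects (a - b) \<and>
           g \<le> s \<and> g \<le> t \<and> s + t \<le> x}" (is "rank_lt _ ?S")
proof -
  \<comment> \<open>Half of the available room, because each of the two summands contributes an
    error \<open>\<eta>\<close>.\<close>
  define \<eta> where "\<eta> = (threshold a (Suc k) - x) / 2"
  have \<eta>: "\<eta> > 0" "x + 2 * \<eta> = threshold a (Suc k)" using x by (auto simp: \<eta>_def field_simps)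
  \<comment> \<open>The cut at \<open>x - g\<close> is legitimate because the other summand is at
    least \<open>g\<close>; it brings \<open>T b i\<close> within reach of the hypothesis
    \<open>IH\<close>.\<close>
  define T where "T b i = all_defects b \<inter> {..min (x - g) (threshold b (Suc i) - \<eta>)}" for b i
  define P where "P b i j = {s + t | s t. s \<in> T b i \<and> t \<in> T (a - b) j}" for b i j
  define I where "I = {0..2::int} \<times> {(i, j). i + j \<le> k}"
  have T: "rank_lt (Suc i) (T b i)" for b i
    unfolding T_def
  proof (rule IH)
    show "min (x - g) (threshold b (Suc i) - \<eta>) < threshold b (Suc i)" using \<eta>(1) by simp
  qed simp
  have "finite {(i, j). i + j \<le> k}"
    by (rule finite_subset[of _ "{..k} \<times> {..k}"]) auto
  then have "finite I" by (simp add: I_def)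
  moreover have "rank_lt (Suc k) (case p of (b, i, j) \<Rightarrow> P b i j)" if "p \<in> I" for p
  proof -
    obtain b i j where p: "p = (b, i, j)" by (cases p)
    then have "i + j \<le> k" using that by (simp add: I_def)
    have "rank_lt (Suc (i + j)) (P b i j)" unfolding P_def by (rule rank_lt_sum[OF T T])
    then show ?thesis using p \<open>i + j \<le> k\<close> rank_lt_mono[of "Suc (i + j)" "Suc k"]
      by (simp del: rank_lt.simps)
  qed
  ultimately have "rank_lt (Suc k) (\<Union>p\<in>I. case p of (b, i, j) \<Rightarrow> P b i j)" by (rule rank_lt_UN)
  moreover have "?S \<subseteq> (\<Union>p\<in>I. case p of (b, i, j) \<Rightarrow> P b i j)"
  proof
    fix d assume "d \<in> ?S"
    then obtain s t b where d: "d = s + t" "s \<in> all_defects b" "t \<in> all_defects (a - b)"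
        "g \<le> s" "g \<le> t" "s + t \<le> x" by blast
    define c where "c = b mod 3"
    have "[c = b] (mod 3)" by (simp add: c_def cong_def)
    then have "[a - c = a - b] (mod 3)" by (intro cong_diff) auto
    have cong: "all_defects p = all_defects q" if "[p = q] (mod 3)" for p q
      using that by (simp add: all_defects_def cong_def)
    have st: "s \<in> all_defects c" "t \<in> all_defects (a - c)"
      using d cong[OF \<open>[c = b] (mod 3)\<close>] cong[OF \<open>[a - c = a - b] (mod 3)\<close>] by auto
    obtain i where i: "s \<le> threshold c (Suc i) - \<eta>" "threshold c i - \<eta> < s"
      using between_thresholds[OF class_min_le_all_defects[OF st(1)] \<eta>(1)] by blast
    obtain j where j: "t \<le> threshold (a - c) (Suc j) - \<eta>" "threshold (a - c) j - \<eta> < t"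
      using between_thresholds[OF class_min_le_all_defects[OF st(2)] \<eta>(1)] by blast
    have "threshold a (i + j) < threshold a (Suc k)"
      using threshold_add[of c "a - c" i j] i j d(6) \<eta>(2) by simp
    then have "i + j \<le> k" by (simp add: threshold_less_iff)
    then have "(c, i, j) \<in> I" by (auto simp: I_def c_def)
    moreover have "s \<in> T c i" "t \<in> T (a - c) j" unfolding T_def using st i j d by auto
    then have "d \<in> P c i j" unfolding P_def using d(1) by blast
    ultimately show "d \<in> (\<Union>p\<in>I. case p of (b, i, j) \<Rightarrow> P b i j)" by blast
  qed
  ultimately show ?thesis by (rule rank_lt_subset)
qed

text \<open>For the least \<open>n\<close> with the given defect and class, no factor of an optimal product is a
  power of 3, so both factors have defect at least \<open>class_min 2\<close>. This makes the induction in
  \<open>rank_lt_below_threshold\<close>, in steps of \<open>class_min 2\<close>, work.\<close>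

lemma all_defects_cases:
  assumes "d \<in> all_defects a"
  obtains (one) "d = defect 1"
  | (add) u v where "0 < v" "v \<le> u" "cpx (u + v) = cpx u + cpx v"
      "[int (cpx (u + v)) = a] (mod 3)" "d = defect (u + v)"
  | (mult) s t b where "s \<in> all_defects b" "t \<in> all_defects (a - b)" "class_min 2 \<le> s" "class_min 2 \<le> t" "d = s + t"
proof -
  define Q where "Q n \<longleftrightarrow> n > 0 \<and> [int (cpx n) = a] (mod 3) \<and> d = defect n" for n
  define n where "n = (LEAST n. Q n)"
  have "\<exists>n. Q n" using assms by (auto simp: Q_def all_defects_def)
  then have n: "n > 0" "[int (cpx n) = a] (mod 3)" "d = defect n"
    unfolding n_def using LeastI_ex[of Q] unfolding Q_def by blast+
  have min: "\<not> Q m" if "m < n" for m using that not_less_Least unfolding n_def by blast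
  have factor: "class_min 2 \<le> defect u"
    if uv: "n = u * v" "u > 1" "v > 1" "cpx n = cpx u + cpx v" for u v
  proof (rule ccontr)
    assume "\<not> ?thesis"
    then obtain j where j: "u = 3 ^ j" "cpx u = 3 * j"
      using defect_less_gap[of u] uv by auto
    then have "defect u = 0" by (simp add: defect_def log_nat_power)
    then have "d = defect v" using defect_mult[of u v] uv n(3) by simp
    moreover have "[int (cpx v) = a] (mod 3)"
      using n(2) uv(4) j(2) by (simp add: cong_def)
    ultimately have "Q v" using uv by (simp add: Q_def)
    then show False using min[of v] uv by simp
  qed
  show thesis
  proof (cases "n = 1")
    case True
    then show thesis using n(3) one by simp
  next
    case False
    then have "n > 1" using n(1) by simp
    then show thesis
    proof (cases rule: cpx_cases)
      case (add u v)
      then show thesis using that(2)[of v u] n by simp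
    next
      case (mult u v)
      have "defect u \<in> all_defects (int (cpx u))"
        using mult by (auto simp: all_defects_def)
      moreover have "[int (cpx v) = a - int (cpx u)] (mod 3)"
        using n(2) unfolding mult(4) cong_iff_dvd_diff by (simp add: algebra_simps)
      then have "defect v \<in> all_defects (a - int (cpx u))"
        using mult by (auto simp: all_defects_def)
      moreover have "class_min 2 \<le> defect u" using factor[of u v] mult by simp
      moreover have "class_min 2 \<le> defect v" using factor[of v u] mult by (simp add: ac_simps)
      moreover have "d = defect u + defect v" using defect_mult[of u v] mult n(3) by simp
      ultimately show thesis by (rule that(3))
    qed
  qed
qed

text \<open>As \<open>v \<le> u\<close>, the correction is at most 3. Hence only finitely many
  smaller summands \<open>v\<close> occur for defects up to a given bound.\<close>

lemma cpx_le_defect_add: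
  assumes "0 < v" "v \<le> u" "cpx (u + v) = cpx u + cpx v"
  shows "real (cpx v) \<le> defect (u + v) + 3"
proof -
  have "log 3 (1 + real v / real u) \<le> log 3 3"
    using assms by (subst log_le_cancel_iff) (auto simp: divide_le_eq intro: add_pos_nonneg)
  then show ?thesis
    using defect_add[of u v] defect_nonneg[of u] assms by simp
qed

lemma finite_cpx_le: "finite {v. v > 0 \<and> real (cpx v) \<le> y}"
proof -
  have "v \<le> Eform (nat \<lfloor>y\<rfloor>)" if "v > 0" "real (cpx v) \<le> y" for v
  proof -
    have "cpx v \<le> nat \<lfloor>y\<rfloor>" using that(2) by (simp add: le_nat_floor)
    then have "Eform (cpx v) \<le> Eform (nat \<lfloor>y\<rfloor>)" by (rule monoD[OF strict_mono_mono[OF Eform_mono_strict]])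
    then show ?thesis using le_Eform_cpx[OF that(1)] by simp
  qed
  then have "{v. v > 0 \<and> real (cpx v) \<le> y} \<subseteq> {..Eform (nat \<lfloor>y\<rfloor>)}" by auto
  then show ?thesis by (rule finite_subset) simp
qed

text \<open>The induction on \<open>m\<close> measures \<open>x\<close> in units of
  \<open>class_min 2\<close>, with class and exponent arbitrary. Both a proper factor and a summand
  leave a bound lower by at least one unit.\<close>

lemma rank_lt_below_threshold:
  assumes "x < threshold a k"
  shows "rank_lt k (all_defects a \<inter> {..x})"
proof -
  have gap: "0 < class_min 2" "class_min 2 \<le> 1 / 2" using log_3_2 by (auto simp: class_min_def)
  have "rank_lt k (all_defects a \<inter> {..x})" if "x < real m * class_min 2" "x < threshold a k" for m x a k
    using that
  proof (induction m arbitrary: x a k)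
    case 0
    then have "all_defects a \<inter> {..x} = {}"
      using class_min_le_all_defects[of _ a] class_min_nonneg[of a] by fastforce
    then show ?case by simp
  next
    case (Suc m)
    have step: "x - class_min 2 < real m * class_min 2" using Suc.prems(1) by (simp add: algebra_simps)
    show ?case
    proof (cases k)
      case 0
      then have "all_defects a \<inter> {..x} = {}"
        using class_min_le_all_defects[of _ a] Suc.prems(2) by (fastforce simp: threshold_def)
      then show ?thesis by simp
    next
      case (Suc l)
      \<comment> \<open>\<open>\<eta> \<le> 1 / 2\<close> makes the loss
        \<open>cpx v - \<eta>\<close> at least \<open>class_min 2\<close>; the other bound keeps
        \<open>x + \<eta>\<close> below the threshold.\<close>
      define \<eta> where "\<eta> = min (threshold a k - x) 1 / 2"
      have \<eta>: "\<eta> > 0" "\<eta> \<le> 1 / 2" "x + \<eta> < threshold a k" using Suc.prems(2) by (auto simp: \<eta>_def min_def field_simps)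
      let ?V = "{v. v > 0 \<and> real (cpx v) \<le> x + 3}"
      let ?A = "\<lambda>v. {defect (u + v) | u. u \<ge> v \<and> cpx (u + v) = cpx u + cpx v \<and>
           [int (cpx (u + v)) = a] (mod 3) \<and> defect (u + v) \<le> x}"
      let ?M = "{s + t | s t b. s \<in> all_defects b \<and> t \<in> all_defects (a - b) \<and>
           class_min 2 \<le> s \<and> class_min 2 \<le> t \<and> s + t \<le> x}"
      have "rank_lt k (?A v)" if "v \<in> ?V" for v
        unfolding Suc
      proof (rule rank_lt_sums[OF _ \<eta>(1)])
        show "v > 0" using that by simp
        then have c: "cpx v \<ge> 1" by (rule cpx_pos)
        show "rank_lt l (all_defects (a - int (cpx v)) \<inter> {..x - real (cpx v) + \<eta>})"
        proof (rule Suc.IH)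
          show "x - real (cpx v) + \<eta> < real m * class_min 2" using c \<eta>(2) gap step by simp
          show "x - real (cpx v) + \<eta> < threshold (a - int (cpx v)) l"
            using threshold_shift[OF c, of a l] \<eta>(3) Suc by simp
        qed
      qed
      then have "rank_lt k (\<Union>v\<in>?V. ?A v)" by (rule rank_lt_UN[OF finite_cpx_le])
      moreover have "rank_lt k ?M"
        unfolding Suc
      proof (rule rank_lt_products[OF _ gap(1)])
        show "x < threshold a (Suc l)" using Suc.prems(2) Suc by simp
        show "rank_lt i (all_defects b \<inter> {..y})" if "y \<le> x - class_min 2" "y < threshold b i" for y b i
          using that step by (intro Suc.IH) auto
      qed
      moreover have "rank_lt k {defect 1}" unfolding Suc by (rule rank_lt_finite) simp
      ultimately have "rank_lt k ((\<Union>v\<in>?V. ?A v) \<union> (?M \<union> {defect 1}))" by (intro rank_lt_Un)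
      moreover have "all_defects a \<inter> {..x} \<subseteq> (\<Union>v\<in>?V. ?A v) \<union> (?M \<union> {defect 1})"
      proof
        fix d assume "d \<in> all_defects a \<inter> {..x}"
        then have "d \<in> all_defects a" and dx: "d \<le> x" by auto
        then show "d \<in> (\<Union>v\<in>?V. ?A v) \<union> (?M \<union> {defect 1})"
        proof (cases rule: all_defects_cases)
          case one
          then show ?thesis by simp
        next
          case (add u v)
          then have "v \<in> ?V" using cpx_le_defect_add[of v u] dx by simp
          moreover have "d \<in> ?A v" using add dx by blast
          ultimately show ?thesis by blast
        next
          case (mult s t b)
          then have "d \<in> ?M" using dx by blast
          then show ?thesis by blast
        qed
      qed
      ultimately show ?thesis by (rule rank_lt_subset)
    qed
  qed
  moreover obtain m where "x < real m * class_min 2" using reals_Archimedean3[OF gap(1)] by blast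
  ultimately show ?thesis using assms by blast
qed

section \<open>Lower bound\<close>

text \<open>The number $(\cdots((B\,3^{x_1+1} + 1)\,3^{x_2+1} + 1) \cdots)\,3^{x_k+1} + 1$ equals a power of 3
  times \<open>B + tail_ratio [x\<^sub>1, \<dots>, x\<^sub>k]\<close>.\<close>

primrec tail_ratio :: "nat list \<Rightarrow> real" where
  "tail_ratio [] = 0"
| "tail_ratio (x # xs) = (1 + tail_ratio xs) / 3 ^ Suc x"

text \<open>The extreme case is a partial sum of 1/3 + 1/9 + 1/27 + ..., whose limit is 1/2.\<close>

lemma tail_ratio_bounds: "0 \<le> tail_ratio xs \<and> tail_ratio xs < 1 / 2"
proof (induction xs)
  case (Cons x xs)
  have "(1::real) \<le> 3 ^ x" by simp
  then have "1 + tail_ratio xs < 1 / 2 * 3 ^ Suc x" using Cons unfolding power_Suc by linarith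
  then have "tail_ratio (x # xs) < 1 / 2" by (simp add: pos_divide_less_eq del: power_Suc)
  moreover have "0 \<le> tail_ratio (x # xs)" using Cons by simp
  ultimately show ?case by blast
qed simp

text \<open>Larger exponents give smaller ratios. At the first difference, the leading term
  \<open>1 / 3 ^ Suc x\<close> alone exceeds the whole competing ratio.\<close>

lemma tail_ratio_less:
  "(xs, ys) \<in> lex less_than \<Longrightarrow> tail_ratio ys < tail_ratio xs"
proof (induction xs arbitrary: ys)
  case (Cons x xs)
  then obtain y ys' where ys: "ys = y # ys'" by (cases ys) auto
  consider "x < y" | "x = y" "(xs, ys') \<in> lex less_than" using Cons.prems by (auto simp: ys)
  then show ?case
  proof cases
    case 1
    then obtain d where d: "y = Suc x + d" using less_iff_Suc_add by auto
    have "(1::real) \<le> 3 ^ d" by simp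
    then have "1 + tail_ratio ys' < 3 ^ Suc d"
      using tail_ratio_bounds[of ys'] unfolding power_Suc by linarith
    then have "(1 + tail_ratio ys') / 3 ^ Suc d < 1" by (simp del: power_Suc)
    then have "(1 + tail_ratio ys') / 3 ^ Suc d / 3 ^ Suc x < 1 / 3 ^ Suc x"
      by (rule divide_strict_right_mono) simp
    moreover have "tail_ratio ys = (1 + tail_ratio ys') / 3 ^ Suc d / 3 ^ Suc x"
      by (simp add: ys d power_add)
    moreover have "1 / 3 ^ Suc x \<le> tail_ratio (x # xs)"
      using tail_ratio_bounds[of xs] unfolding tail_ratio.simps by (intro divide_right_mono) auto
    ultimately show ?thesis by linarith
  next
    case 2
    then show ?thesis using Cons.IH by (simp add: ys divide_strict_right_mono)
  qed
qed simp

lemma cpx_Suc: "n > 0 \<Longrightarrow> cpx (n + 1) \<le> cpx n + 1"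
  using cpx_attained[of n] cpx_le[of "EAdd _ EOne"] by (metis expr_ones.simps(1,2) expr_val.simps(1,2))

text \<open>\<open>s\<close> is the total exponent of 3. The bound counts 3 for each multiplication
  by 3 and 1 for each added one.\<close>

lemma tail_ratio_number:
  assumes "B > 0"
  shows "\<exists>s V. real V = 3 ^ s * (real B + tail_ratio xs) \<and> B \<le> V \<and> cpx V \<le> cpx B + 3 * s + length xs"
  using assms
proof (induction xs arbitrary: B)
  case Nil
  then show ?case by (intro exI[of _ 0] exI[of _ B]) simp
next
  case (Cons x xs)
  \<comment> \<open>The innermost step is absorbed into the base, so the induction runs from the
    inside outwards.\<close>
  let ?B = "3 ^ Suc x * B + 1"
  obtain s V where V: "real V = 3 ^ s * (real ?B + tail_ratio xs)" "?B \<le> V"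
      "cpx V \<le> cpx ?B + 3 * s + length xs"
    using Cons.IH[of ?B] by auto
  have "real V = 3 ^ (s + Suc x) * (real B + tail_ratio (x # xs))"
  proof -
    have "3 ^ Suc x * (real B + tail_ratio (x # xs)) = real ?B + tail_ratio xs"
      unfolding tail_ratio.simps distrib_left by (simp del: power_Suc)
    then show ?thesis unfolding V(1) power_add mult.assoc by (rule arg_cong[OF sym])
  qed
  moreover have "B \<le> V"
  proof -
    have "1 * B \<le> 3 ^ Suc x * B" by (intro mult_le_mono1 one_le_power) simp
    then show ?thesis using V(2) by linarith
  qed
  moreover have "cpx ?B \<le> cpx (3 ^ Suc x * B) + 1" using Cons.prems by (intro cpx_Suc) simp
  then have "cpx V \<le> cpx B + 3 * (s + Suc x) + length (x # xs)"
    using V(3) cpx_3_pow[of B "Suc x"] Cons.prems by simp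
  ultimately show ?case by blast
qed

text \<open>These are the exceptional values, where the true complexity is smaller by
  \<open>i\<close>. By \<open>threshold_shift\<close> each proper initial segment ends below
  threshold \<open>l\<close> of the class \<open>a - i\<close>, so the upper bound applies to
  it.\<close>

lemma rank_lt_shifted_all_defects:
  assumes "i \<ge> 1"
  shows "rank_lt (Suc l) ((\<lambda>t. t + real i) ` (all_defects (a - int i) \<inter> {..<threshold a (Suc l) - real i}))"
proof (rule rank_lt_translate, rule rank_lt_SucI)
  fix y assume "y \<in> all_defects (a - int i) \<inter> {..<threshold a (Suc l) - real i}"
  then have "y < threshold (a - int i) l" using threshold_shift[OF assms, of a l] by simp
  from rank_lt_below_threshold[OF this]
  show "rank_lt l (all_defects (a - int i) \<inter> {..<threshold a (Suc l) - real i} \<inter> {..<y})"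
    by (rule rank_lt_subset) auto
qed

text \<open>The defects \<open>g xs\<close> computed from the obvious representations form a copy of $\omega^k$. If the
  stable complexity is smaller by \<open>i > 0\<close>, then \<open>g xs - i\<close> is a defect below the threshold
  \<open>k - 1\<close> of the class \<open>a - i\<close>; by the upper bound such \<open>xs\<close> account for rank less than
  $\omega^k$ only.\<close>

lemma not_rank_lt_defects_st: "\<not> rank_lt k (defects_st a \<inter> {0..threshold a k})"
proof
  assume rank: "rank_lt k (defects_st a \<inter> {0..threshold a k})"
  \<comment> \<open>Adding 3 to the residue secures \<open>m \<ge> 2\<close>, where
    \<open>Eform_log\<close> is an equality.\<close>
  obtain m where m: "m \<ge> 2" "[int m = a - int k] (mod 3)"
  proof
    show "[int (nat ((a - int k) mod 3) + 3) = a - int k] (mod 3)" by (simp add: cong_def)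
  qed simp
  let ?E = "Eform m"
  \<comment> \<open>The defect that the number built from \<open>?E\<close> and \<open>xs\<close>
    would have if its representation were optimal; the powers of 3 cancel.\<close>
  define g where "g xs = real k + real m - 3 * log 3 (real ?E + tail_ratio xs)" for xs
  have E: "?E \<ge> 2" using Eform_ge[of m] m(1) by linarith
  have thr: "threshold a k = real k + real m - 3 * log 3 (real ?E)"
    using Eform_log[OF m(1)] class_min_cong[OF m(2)] by (simp add: threshold_def)
  have g_le: "g xs \<le> threshold a k" for xs
  proof -
    have "log 3 (real ?E) \<le> log 3 (real ?E + tail_ratio xs)"
      using E tail_ratio_bounds[of xs] by (subst log_le_cancel_iff) auto
    then show ?thesis by (simp add: g_def thr)
  qed
  define X where "X = defects_st a \<inter> {0..threshold a k}"
  define Y where "Y i = (\<lambda>t. t + real i) ` (all_defects (a - int i) \<inter> {..<threshold a k - real i})" for i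
  define N where "N = nat \<lfloor>threshold a k\<rfloor>"
  have cover: "g xs \<in> X \<or> k > 0 \<and> g xs \<in> (\<Union>i\<in>{1..N}. Y i) \<union> {threshold a k}" if len: "length xs = k" for xs
  proof -
    obtain s V where V: "real V = 3 ^ s * (real ?E + tail_ratio xs)" "?E \<le> V"
        "cpx V \<le> cpx ?E + 3 * s + length xs"
      using tail_ratio_number[of ?E xs] E by auto
    obtain j where j: "stable_num (3 ^ j * V)" using stable_exists[of V] V(2) E by auto
    let ?M = "3 ^ j * V"
    have "1 * V \<le> ?M" by (intro mult_le_mono1 one_le_power) simp
    then have M: "?M > 1" using V(2) E by linarith
    then have M_pos: "?M > 0" by linarith
    have "cpx ?E \<le> m" using Eform_greatest(1)[of m] m(1) by simp
    then have "cpx ?M \<le> m + 3 * s + k + 3 * j"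
      using cpx_3_pow[of V j] V(2,3) E len by simp
    \<comment> \<open>\<open>i\<close> is what the stable multiple saves against the obvious
      representation; \<open>i = 0\<close> is the regular case.\<close>
    then obtain i where i: "m + 3 * s + k + 3 * j = cpx ?M + i" using le_Suc_ex by blast
    have pos: "real ?E + tail_ratio xs > 0" using E tail_ratio_bounds[of xs] by simp
    have "real ?M = 3 ^ (j + s) * (real ?E + tail_ratio xs)" by (simp add: V(1) power_add)
    then have "log 3 (real ?M) = real (j + s) + log 3 (real ?E + tail_ratio xs)"
      using pos by (simp add: log_mult_pos log_nat_power)
    moreover have "real m + 3 * real s + real k + 3 * real j = real (cpx ?M) + real i"
      using arg_cong[OF i, of real] by simp
    ultimately have d: "defect ?M = g xs - real i" by (simp add: defect_def g_def)
    have nonneg: "defect ?M \<ge> 0" using M_pos by (rule defect_nonneg)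
    have cong: "[int (cpx ?M) = a - int i] (mod 3)"
    proof -
      have "int (cpx ?M) = int m + int k - int i + 3 * (int s + int j)"
        using arg_cong[OF i, of int] by simp
      then have "int (cpx ?M) - (a - int i) = (int m - (a - int k)) + 3 * (int s + int j)" by simp
      moreover have "3 dvd int m - (a - int k)" using m(2) by (simp only: cong_iff_dvd_diff)
      ultimately show ?thesis unfolding cong_iff_dvd_diff by (metis dvd_add dvd_triv_left)
    qed
    show ?thesis
    proof (cases "i = 0")
      case True
      then have "g xs = defect ?M" "[int (cpx ?M) = a] (mod 3)" using d cong by auto
      moreover have "?M > 0" "?M \<noteq> 1" using M by linarith+
      ultimately have "g xs \<in> defects a" unfolding defects_def by blast
      moreover have "g xs \<in> stable_defects" unfolding stable_defects_def using j \<open>g xs = defect ?M\<close> by blast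
      ultimately have "g xs \<in> X" using nonneg g_le[of xs] \<open>g xs = defect ?M\<close> by (simp add: X_def defects_st_def)
      then show ?thesis ..
    next
      case False
      have le: "real i \<le> threshold a k" using nonneg d g_le[of xs] by linarith
      then have "i \<in> {1..N}" using False by (simp add: N_def le_nat_floor)
      \<comment> \<open>For \<open>k = 0\<close> the threshold is a class minimum, below 1, which
        leaves no room for a saving.\<close>
      have "k > 0"
      proof (rule ccontr)
        assume "\<not> k > 0"
        then have "threshold a k < 1" using class_min_less_1[of a] by (simp add: threshold_def)
        then show False using le False by simp
      qed
      \<comment> \<open>\<open>Y i\<close> stops strictly below the threshold whereas
        \<open>g_le\<close> is not strict, so the value \<open>threshold a k\<close> is put into a
        separate singleton.\<close>
      moreover have "g xs \<in> Y i" if "g xs \<noteq> threshold a k"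
      proof -
        have "defect ?M \<in> all_defects (a - int i)" unfolding all_defects_def using M_pos cong by blast
        moreover have "defect ?M < threshold a k - real i" using that g_le[of xs] d by simp
        moreover have "g xs = defect ?M + real i" using d by simp
        ultimately show ?thesis unfolding Y_def by blast
      qed
      ultimately show ?thesis using \<open>i \<in> {1..N}\<close> by blast
    qed
  qed
  define Z where "Z = (if k > 0 then (\<Union>i\<in>{1..N}. Y i) \<union> {threshold a k} else {})"
  have "rank_lt k Z"
  proof (cases k)
    case (Suc l)
    have "rank_lt k (Y i)" if "i \<in> {1..N}" for i
      unfolding Y_def Suc using that by (intro rank_lt_shifted_all_defects) simp
    then have "rank_lt k (\<Union>i\<in>{1..N}. Y i)" by (intro rank_lt_UN) auto
    moreover have "rank_lt k {threshold a k}" unfolding Suc by (rule rank_lt_finite) simp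
    ultimately have "rank_lt k ((\<Union>i\<in>{1..N}. Y i) \<union> {threshold a k})" by (rule rank_lt_Un)
    then show ?thesis using Suc by (simp add: Z_def del: rank_lt.simps)
  qed (simp add: Z_def)
  then have "rank_lt k (X \<union> Z)" using rank by (intro rank_lt_Un) (simp_all add: X_def)
  moreover have "omega_emb k g (X \<union> Z)"
  proof (rule omega_embI)
    show "g xs \<in> X \<union> Z" if "length xs = k" for xs using cover[OF that] by (auto simp: Z_def)
    fix xs ys :: "nat list" assume "(xs, ys) \<in> lex less_than"
    then have "log 3 (real ?E + tail_ratio ys) < log 3 (real ?E + tail_ratio xs)"
      using E tail_ratio_less[of xs ys] tail_ratio_bounds[of ys] tail_ratio_bounds[of xs]
      by (subst log_less_cancel_iff) auto
    then show "g xs < g ys" by (simp add: g_def)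
  qed
  ultimately show False using rank_lt_no_omega_emb by blast
qed

section \<open>The integer defect as least exponent\<close>

text \<open>Any \<open>X\<close> between the stable and all defects of the class is allowed, so one
  argument serves both halves of the theorem. \<open>E(L) \<le> m < E(L + 1)\<close> places the
  defect above all thresholds with index less than \<open>K\<close> and not above threshold
  \<open>K\<close>.\<close>

lemma int_defect_eq_Least:
  assumes m: "m > 1" and X: "defects_st (int (cpx m)) \<subseteq> X" "X \<subseteq> defects (int (cpx m))"
  shows "(\<exists>k. rank_lt k (X \<inter> {0..<defect m})) \<and>
    int_defect m = int (LEAST k. rank_lt k (X \<inter> {0..<defect m}))"
proof -
  define L c K where "L = Lmax m" and "c = cpx m" and "K = cpx m - Lmax m"
  have all: "X \<subseteq> all_defects (int c)"
    using X(2) unfolding c_def defects_def all_defects_def by blast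
  have L2: "L \<ge> 2" unfolding L_def using m
    by (intro Lmax_greatest(2)) (auto simp: Emax_eq numeral_2_eq_2)
  have le: "Eform L \<le> m"
    using Lmax_greatest(1)[of m] m Emax_eq[of L] L2 by (simp add: L_def)
  have gt: "Eform (Suc L) > m"
    using Lmax_greatest(2)[of m "Suc L"] m Emax_eq[of "Suc L"] by (force simp: L_def)
  have "Eform L \<le> Eform c" using le le_Eform_cpx[of m] m by (simp add: c_def)
  then have "L \<le> c" using strict_mono_less_eq[OF Eform_mono_strict] by blast
  then have K: "int_defect m = int K" "c = L + K" by (auto simp: int_defect_def K_def L_def c_def)
  have rank: "rank_lt K (X \<inter> {0..<defect m})"
  proof (cases "K = 0")
    case True
    have "log 3 (real (Eform L)) \<le> log 3 (real m)"
      using le Eform_pos[of L] L2 m by (subst log_le_cancel_iff) auto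
    then have "defect m \<le> class_min (int c)"
      using Eform_log[OF L2] K(2) True by (simp add: defect_def c_def)
    then have "X \<inter> {0..<defect m} = {}" using class_min_le_all_defects[of _ "int c"] all by force
    then show ?thesis by simp
  next
    case False
    have "m \<noteq> Eform L" using Eform_greatest(1)[of L] L2 K(2) False by (auto simp: c_def)
    then have "log 3 (real (Eform L)) < log 3 (real m)"
      using le Eform_pos[of L] L2 m by (subst log_less_cancel_iff) auto
    then have "defect m < threshold (int c) K"
      using Eform_log[OF L2] K(2) by (simp add: defect_def threshold_def c_def)
    from rank_lt_below_threshold[OF this] show ?thesis
      by (rule rank_lt_subset) (use all in auto)
  qed
  have least: "K \<le> k" if "rank_lt k (X \<inter> {0..<defect m})" for k
  proof (rule ccontr)
    assume "\<not> K \<le> k"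
    then have k: "Suc L \<le> c - k" "int (c - k) = int c - int k" "real (c - k) = real c - real k"
      using K(2) by auto
    \<comment> \<open>As \<open>k < K\<close>, the index \<open>c - k\<close> exceeds
      \<open>L\<close>, so maximality of \<open>L\<close> applies.\<close>
    have "m < Eform (c - k)"
      using gt monoD[OF strict_mono_mono[OF Eform_mono_strict] k(1)] by linarith
    then have "log 3 (real m) < log 3 (real (Eform (c - k)))"
      using m by (subst log_less_cancel_iff) auto
    then have "threshold (int c) k < defect m"
      using Eform_log[of "c - k"] L2 k by (simp add: defect_def threshold_def c_def)
    then have "defects_st (int c) \<inter> {0..threshold (int c) k} \<subseteq> X \<inter> {0..<defect m}"
      using X(1) by (auto simp: c_def)
    then show False using rank_lt_subset[OF that] not_rank_lt_defects_st by blast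
  qed
  show ?thesis using rank least K(1) Least_equality[of "\<lambda>k. rank_lt k (X \<inter> {0..<defect m})" K] by auto
qed

theorem theorem4p2:
  fixes n :: nat
  assumes "n > 1"
  shows "(let \<zeta> = ord_type (defects (int (cpx n)) \<inter> {0..<defect n})
          in (\<exists>k. (\<zeta>, omega_pow k) \<in> ordLess) \<and>
             int_defect n = int (LEAST k. (\<zeta>, omega_pow k) \<in> ordLess)) \<and>
         (let \<zeta>' = ord_type (defects_st (cpx_st n) \<inter> {0..<defect_st n})
          in (\<exists>k. (\<zeta>', omega_pow k) \<in> ordLess) \<and>
             int_defect_st n = int (LEAST k. (\<zeta>', omega_pow k) \<in> ordLess))"
proof -
  let ?M = "3 ^ stable_exp n * n"
  have "1 * n \<le> ?M" by (intro mult_le_mono1 one_le_power) simp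
  then have M: "?M > 1" using assms by linarith
  \<comment> \<open>Stable complexity differs from the complexity of \<open>?M\<close> by a multiple
    of 3, so both name the same class; the other stable notions of \<open>n\<close> are by
    definition those of \<open>?M\<close>.\<close>
  have "[cpx_st n = int (cpx ?M)] (mod 3)"
    by (simp add: cpx_st_def cong_iff_dvd_diff)
  then have "defects_st (cpx_st n) = defects_st (int (cpx ?M))"
    by (simp add: defects_st_def defects_def cong_def)
  moreover have "defects_st a \<subseteq> defects a" for a by (simp add: defects_st_def)
  ultimately show ?thesis
    using int_defect_eq_Least[OF assms, of "defects (int (cpx n))"]
      int_defect_eq_Least[OF M, of "defects_st (int (cpx ?M))"]
    unfolding Let_def ordLess_omega_pow_iff int_defect_st_def defect_st_def by simp
qed

end
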